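(* Suppose that the error estimators $\eta_{u,\star}$ and $\eta_{z,\star}$ satisfy the axioms (A1), (A2), (A3), (A4) (without loss of generality with the same constants for $w=u$ and $w=z$). Suppose that the mesh-refinement satisfies the son estimate (M1) as well as the mesh-closure estimate (M2) and the overlay estimate (M3). Let $0<\theta<\theta_\star:=(1+C_{\rm stb}^2C_{\rm rel}^2)^{-1}$ be sufficiently small, where $\theta$ is the marking parameter of Algorithm 1. Then there exists a constant $C_{\rm opt}>0$, which depends only on $\theta$, $C_{\rm mesh}$, and (A1)--(A4), such that for all $s,t>0$ the assumption $(u,z)\in\mathbb A_s\times\mathbb A_t$ implies, for all $\ell\in\mathbb N_0$, $$C_{\rm goal}^{-1}\,|g-g_\ell|\le\eta_{u,\ell}\,\eta_{z,\ell}\le\frac{C_{\rm opt}^{\,1+s+t}}{\big(1-q_{\rm lin}^{1/(s+t)}\big)^{s+t}}\;\|u\|_{\mathbb A_s}\|z\|_{\mathbb A_t}\,(\#\mathcal T_\ell-\#\mathcal T_0)^{-(s+t)} ,$$ i.e., Algorithm 1 guarantees that the estimator product decays asymptotically with any possible algebraic rate. Here $0<q_{\rm lin}<1$ is the linear convergence constant, and $g$, $g_\ell$, $C_{\rm goal}$ are the goal quantity, its approximation, and the constant of the goal error estimate, all described in the context.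
   Context: **Mesh refinement.** A triangulation is a finite set of elements. A fixed deterministic mesh-refinement strategy is given: for a triangulation $\mathcal T$ and $\mathcal M\subseteq\mathcal T$, $\mathtt{refine}(\mathcal T,\mathcal M)$ is the coarsest triangulation in which all elements of $\mathcal M$ have been refined (so $\mathcal M\subseteq\mathcal T\setminus\mathtt{refine}(\mathcal T,\mathcal M)$; further elements may be refined, e.g. to preserve conformity or shape regularity). Write $\mathcal T'\in\mathtt{refine}(\mathcal T)$ if $\mathcal T'$ is obtained from $\mathcal T$ by finitely many (possibly zero) such refinement steps. $\mathcal T_0$ is a given initial triangulation and $\mathbb T:=\mathtt{refine}(\mathcal T_0)$. **Mesh properties.** (M1) $\#(\mathcal T\setminus\mathcal T')+\#\mathcal T\le\#\mathcal T'$ for all $\mathcal T\in\mathbb T$, $\mathcal T'\in\mathtt{refine}(\mathcal T)$. (M2) $\#\mathcal T_\ell-\#\mathcal T_0\le C_{\rm mesh}\sum_{j=0}^{\ell-1}\#\mathcal M_j$ for all $\ell\in\mathbb N$, where $\mathcal M_j$ are the marked sets and $C_{\rm mesh}>0$ depends only on $\mathcal T_0$. (M3) For all $\mathcal T,\mathcal T'\in\mathbb T$ there is a common refinement $\mathcal T\oplus\mathcal T'\in\mathtt{refine}(\mathcal T)\cap\mathtt{refine}(\mathcal T')$ with $\#(\mathcal T\oplus\mathcal T')\le\#\mathcal T+\#\mathcal T'-\#\mathcal T_0$. **Estimators.** For $w\in\{u,z\}$ and each $\mathcal T_\star\in\mathbb T$ there are local contributions $\eta_{w,\star}(T)\ge0$,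 $T\in\mathcal T_\star$. Put $\eta_{w,\star}(\mathcal U)=\big(\sum_{T\in\mathcal U}\eta_{w,\star}(T)^2\big)^{1/2}$ for $\mathcal U\subseteq\mathcal T_\star$ and $\eta_{w,\star}=\eta_{w,\star}(\mathcal T_\star)$. The index of $\eta$ matches that of the triangulation (e.g. $\eta_{w,\ell}$ belongs to $\mathcal T_\ell$). In the abstract setting $u,z$ serve only as labels. **Goal quantity.** $g$ is the quantity of interest, $g_\ell$ its approximation computed on $\mathcal T_\ell$, and $C_{\rm goal}>0$ is the constant in the goal error estimate $|g-g_\ell|\le C_{\rm goal}\,\eta_{u,\ell}\eta_{z,\ell}$, which is the standing link between goal error and estimator product. In the main application: $\mathcal X$ is a Hilbert space, $a(\cdot,\cdot)$ a continuous and elliptic bilinear form on $\mathcal X$, $f$ and $G$ are continuous linear functionals on $\mathcal X$ ($G$ being the goal functional), and $u,z\in\mathcal X$ solve $a(u,v)=f(v)$ and $a(v,z)=G(v)$ for all $v\in\mathcal X$. With each triangulation $\mathcal T_\ell$ there is associated a finite-dimensional subspace $\mathcal X_\ell\subseteq\mathcal X$, and $U_\ell,Z_\ell\in\mathcal X_\ell$ solve $a(U_\ell,V)=f(V)$ and $a(V,Z_\ell)=G(V)$ for all $V\in\mathcal X_\ell$. The estimators are reliable, i.e. $\|u-U_\ell\|_{\mathcal X}\lesssim\eta_{u,\ell}$ and $\|z-Z_\ell\|_{\mathcal X}\lesssim\eta_{z,\ell}$ with constants independent of $\ell$. Then $g:=G(u)$, $g_\ell:=G(U_\ell)$, and $|g-g_\ell|=|a(u-U_\ell,z-Z_\ell)|\le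 C_{\rm goal}\,\eta_{u,\ell}\eta_{z,\ell}$, where $C_{\rm goal}$ is given by the continuity bound of $a(\cdot,\cdot)$ and the reliability constants. **Distance.** $\mathrm d_w:\mathbb T\times\mathbb T\to\mathbb R_{\ge0}$ satisfies, with a uniform constant $C_{\rm dist}>0$, $C_{\rm dist}^{-1}\mathrm d_w(\mathcal T,\mathcal T'')\le \mathrm d_w(\mathcal T,\mathcal T')+\mathrm d_w(\mathcal T',\mathcal T'')$ and $\mathrm d_w(\mathcal T,\mathcal T')\le C_{\rm dist}\,\mathrm d_w(\mathcal T',\mathcal T)$ for all $\mathcal T,\mathcal T',\mathcal T''\in\mathbb T$. **Axioms** (for $w\in\{u,z\}$): (A1) There is $C_{\rm stb}>0$ such that for all $\mathcal T_\ell\in\mathbb T$, $\mathcal T_\star\in\mathtt{refine}(\mathcal T_\ell)$: $|\eta_{w,\star}(\mathcal T_\ell\cap\mathcal T_\star)-\eta_{w,\ell}(\mathcal T_\ell\cap\mathcal T_\star)|\le C_{\rm stb}\,\mathrm d_w(\mathcal T_\ell,\mathcal T_\star)$. (A2) There are $0<q_{\rm red}<1$, $C_{\rm red}>0$ such that for all $\mathcal T_\ell\in\mathbb T$, $\mathcal T_\star\in\mathtt{refine}(\mathcal T_\ell)$: $\eta_{w,\star}(\mathcal T_\star\setminus\mathcal T_\ell)^2\le q_{\rm red}\,\eta_{w,\ell}(\mathcal T_\ell\setminus\mathcal T_\star)^2+C_{\rm red}\,\mathrm d_w(\mathcal T_\ell,\mathcal T_\star)^2$. (A3) Let $(\mathcal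 T_{\ell_n})_n$ be the (possibly finite) subsequence of the triangulations $\mathcal T_\ell$ generated by the adaptive algorithm (here Algorithm 1) which satisfy $\theta\,\eta_{w,\ell_n}^2\le\eta_{w,\ell_n}(\mathcal T_{\ell_n}\setminus\mathcal T_{\ell_n+1})^2$. For all $\varepsilon>0$ there is $C_{\rm orth}(\varepsilon)>0$ such that for all $n\le N$ for which $\mathcal T_{\ell_n},\dots,\mathcal T_{\ell_{N+1}}$ are well-defined: $\sum_{j=n}^N\big(\mathrm d_w(\mathcal T_{\ell_{j+1}},\mathcal T_{\ell_j})^2-\varepsilon\,\eta_{w,\ell_j}^2\big)\le C_{\rm orth}(\varepsilon)\,\eta_{w,\ell_n}^2$. (A4) There is $C_{\rm rel}>0$ such that for all $\mathcal T_\ell\in\mathbb T$, $\mathcal T_\star\in\mathtt{refine}(\mathcal T_\ell)$: $\mathrm d_w(\mathcal T_\star,\mathcal T_\ell)\le C_{\rm rel}\,\eta_{w,\ell}(\mathcal R_w(\mathcal T_\ell,\mathcal T_\star))$, where $\mathcal T_\ell\setminus\mathcal T_\star\subseteq\mathcal R_w(\mathcal T_\ell,\mathcal T_\star)\subseteq\mathcal T_\ell$ and $\#\mathcal R_w(\mathcal T_\ell,\mathcal T_\star)\le C_{\rm rel}\,\#(\mathcal T_\ell\setminus\mathcal T_\star)$. **Algorithm 1.** Input: $\mathcal T_0$, $0<\theta\le1$, $C_{\rm mark}\ge1$. For $\ell=0,1,2,\dots$: compute $\eta_{u,\ell}(T),\eta_{z,\ell}(T)$ for all $T\in\mathcal T_\ell$;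 for $w\in\{u,z\}$ determine $\mathcal M_{w,\ell}\subseteq\mathcal T_\ell$ with $\theta\eta_{w,\ell}^2\le\eta_{w,\ell}(\mathcal M_{w,\ell})^2$ whose cardinality is minimal up to the multiplicative factor $C_{\rm mark}$ among all subsets of $\mathcal T_\ell$ with this property; let $\mathcal M_\ell\in\{\mathcal M_{u,\ell},\mathcal M_{z,\ell}\}$ be the set of minimal cardinality; set $\mathcal T_{\ell+1}:=\mathtt{refine}(\mathcal T_\ell,\mathcal M_\ell)$. **Linear convergence constants.** $C_{\rm lin}>0$ and $0<q_{\rm lin}<1$ denote constants depending only on $\theta$ and (A1)--(A4) such that the sequence generated by Algorithm 1 satisfies $\eta_{u,\ell+n}\eta_{z,\ell+n}\le C_{\rm lin}q_{\rm lin}^n\eta_{u,\ell}\eta_{z,\ell}$ for all $\ell,n\in\mathbb N_0$ (such constants exist under (A1)--(A4)). **Approximation classes.** $\mathbb T_N:=\{\mathcal T\in\mathbb T:\#\mathcal T-\#\mathcal T_0\le N\}$ (a finite set). For $s>0$ and $w\in\{u,z\}$, $w\in\mathbb A_s$ means $\|w\|_{\mathbb A_s}:=\sup_{N\in\mathbb N_0}\big((N+1)^s\min_{\mathcal T_\star\in\mathbb T_N}\eta_{w,\star}\big)<\infty$. The rightmost side of the asserted estimate is read as $+\infty$ if $\#\mathcal T_\ell=\#\mathcal T_0$.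
   Formalization: C_opt is also allowed to depend on C_mark (without this the claim fails, as large C_mark permits over-marking) and on C_dist; "sufficiently small" means θ below a threshold that equals θ_⋆ if C_dist ≤ 1; constants are uniform over all settings with a given type of elements. *)

theory Defs
  imports "HOL-Analysis.Analysis"
begin

text \<open>
  A triangulation is a finite set of elements of an arbitrary type.  The refinement strategy is
  a function that maps a triangulation and a set of marked elements to a triangulation;
  \<open>refinements refine T\<close> collects everything reachable from \<open>T\<close> in finitely many steps, so that
  \<open>refinements refine T0\<close> is the set of all admissible triangulations.
\<close>

inductive_set refinements ::
  "('e set \<Rightarrow> 'e set \<Rightarrow> 'e set) \<Rightarrow> 'e set \<Rightarrow> 'e set set"
  for refine :: "'e set \<Rightarrow> 'e set \<Rightarrow> 'e set" and T :: "'e set" where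
  base: "T \<in> refinements refine T"
| step: "T' \<in> refinements refine T \<Longrightarrow> M \<subseteq> T' \<Longrightarrow> refine T' M \<in> refinements refine T"

text \<open>
  The assumption \<open>coarsest\<close> says that \<open>refine T M\<close> is the coarsest refinement of \<open>T\<close> in which all
  elements of \<open>M\<close> are refined: a refinement of \<open>T\<close> contains no element of \<open>M\<close> if and only if it is
  a refinement of \<open>refine T M\<close>.  In particular \<open>M \<subseteq> T - refine T M\<close>, and an element that has been
  refined never reappears.
\<close>

locale mesh_refinement =
  fixes refine :: "'e set \<Rightarrow> 'e set \<Rightarrow> 'e set" and T0 :: "'e set"
  assumes finite_mesh: "T \<in> refinements refine T0 \<Longrightarrow> finite T"
    and coarsest: "T \<in> refinements refine T0 \<Longrightarrow> M \<subseteq> T \<Longrightarrow> T' \<in> refinements refine T \<Longrightarrow>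
      M \<inter> T' = {} \<longleftrightarrow> T' \<in> refinements refine (refine T M)"

definition son_estimate :: "('e set \<Rightarrow> 'e set \<Rightarrow> 'e set) \<Rightarrow> 'e set \<Rightarrow> bool" where
  "son_estimate refine T0 \<longleftrightarrow>
    (\<forall>T\<in>refinements refine T0. \<forall>T'\<in>refinements refine T. card (T - T') + card T \<le> card T')"

definition closure_estimate ::
  "'e set \<Rightarrow> real \<Rightarrow> (nat \<Rightarrow> 'e set) \<Rightarrow> (nat \<Rightarrow> 'e set) \<Rightarrow> bool" where
  "closure_estimate T0 Cmesh T M \<longleftrightarrow>
    (\<forall>l. real (card (T l)) - real (card T0) \<le> Cmesh * (\<Sum>j<l. real (card (M j))))"

definition overlay_estimate :: "('e set \<Rightarrow> 'e set \<Rightarrow> 'e set) \<Rightarrow> 'e set \<Rightarrow> bool" where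
  "overlay_estimate refine T0 \<longleftrightarrow>
    (\<forall>T\<in>refinements refine T0. \<forall>T'\<in>refinements refine T0.
      \<exists>T''\<in>refinements refine T \<inter> refinements refine T'.
        real (card T'') \<le> real (card T) + real (card T') - real (card T0))"

text \<open>\<open>Primal\<close> and \<open>Dual\<close> are the labels \<open>u\<close> and \<open>z\<close>.\<close>

datatype problem = Primal | Dual

text \<open>
  \<open>\<eta> T x\<close> is the local contribution of the element \<open>x\<close> of the triangulation \<open>T\<close>; it may depend
  on the whole triangulation, not only on \<open>x\<close>.
\<close>

definition est :: "('e set \<Rightarrow> 'e \<Rightarrow> real) \<Rightarrow> 'e set \<Rightarrow> 'e set \<Rightarrow> real" where
  "est \<eta> T U = L2_set (\<eta> T) U"

definition total_est :: "('e set \<Rightarrow> 'e \<Rightarrow> real) \<Rightarrow> 'e set \<Rightarrow> real" where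
  "total_est \<eta> T = est \<eta> T T"

definition doerfler :: "('e set \<Rightarrow> 'e \<Rightarrow> real) \<Rightarrow> real \<Rightarrow> 'e set \<Rightarrow> 'e set \<Rightarrow> bool" where
  "doerfler \<eta> \<theta> T U \<longleftrightarrow> U \<subseteq> T \<and> \<theta> * (total_est \<eta> T)\<^sup>2 \<le> (est \<eta> T U)\<^sup>2"

text \<open>
  One run of the algorithm.  \<open>T l\<close> and \<open>M l\<close> are the triangulation and the set of elements actually
  marked in step \<open>l\<close>; \<open>Mw w\<close> is the quasi-minimal set determined for the problem \<open>w\<close>.
\<close>

definition algorithm_run ::
  "('e set \<Rightarrow> 'e set \<Rightarrow> 'e set) \<Rightarrow> 'e set \<Rightarrow> (problem \<Rightarrow> 'e set \<Rightarrow> 'e \<Rightarrow> real) \<Rightarrow> real \<Rightarrow> real \<Rightarrow>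
   (nat \<Rightarrow> 'e set) \<Rightarrow> (nat \<Rightarrow> 'e set) \<Rightarrow> bool" where
  "algorithm_run refine T0 \<eta> \<theta> Cmark T M \<longleftrightarrow>
    T 0 = T0 \<and>
    (\<forall>l. \<exists>Mw :: problem \<Rightarrow> 'e set.
      (\<forall>w. doerfler (\<eta> w) \<theta> (T l) (Mw w) \<and>
        (\<forall>U. doerfler (\<eta> w) \<theta> (T l) U \<longrightarrow> real (card (Mw w)) \<le> Cmark * real (card U))) \<and>
      M l \<in> {Mw Primal, Mw Dual} \<and>
      card (M l) = min (card (Mw Primal)) (card (Mw Dual)) \<and>
      T (Suc l) = refine (T l) (M l))"

definition axiom_stability ::
  "('e set \<Rightarrow> 'e set \<Rightarrow> 'e set) \<Rightarrow> 'e set \<Rightarrow> ('e set \<Rightarrow> 'e \<Rightarrow> real) \<Rightarrow> ('e set \<Rightarrow> 'e set \<Rightarrow> real) \<Rightarrow>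
   real \<Rightarrow> bool" where
  "axiom_stability refine T0 \<eta> d Cstb \<longleftrightarrow>
    (\<forall>T\<in>refinements refine T0. \<forall>T'\<in>refinements refine T.
      \<bar>est \<eta> T' (T \<inter> T') - est \<eta> T (T \<inter> T')\<bar> \<le> Cstb * d T T')"

definition axiom_reduction ::
  "('e set \<Rightarrow> 'e set \<Rightarrow> 'e set) \<Rightarrow> 'e set \<Rightarrow> ('e set \<Rightarrow> 'e \<Rightarrow> real) \<Rightarrow> ('e set \<Rightarrow> 'e set \<Rightarrow> real) \<Rightarrow>
   real \<Rightarrow> real \<Rightarrow> bool" where
  "axiom_reduction refine T0 \<eta> d qred Cred \<longleftrightarrow>
    (\<forall>T\<in>refinements refine T0. \<forall>T'\<in>refinements refine T.
      (est \<eta> T' (T' - T))\<^sup>2 \<le> qred * (est \<eta> T (T - T'))\<^sup>2 + Cred * (d T T')\<^sup>2)"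

text \<open>
  The indices of the subsequence in the quasi-orthogonality axiom are the elements of
  \<open>doerfler_steps\<close> in increasing order.  \<open>enumerate L j\<close> is the \<open>j\<close>-th of them (counting from 0)
  and is meaningful if \<open>L\<close> is infinite or \<open>j < card L\<close>, whence the guard below.
\<close>

definition doerfler_steps ::
  "('e set \<Rightarrow> 'e \<Rightarrow> real) \<Rightarrow> real \<Rightarrow> (nat \<Rightarrow> 'e set) \<Rightarrow> nat set" where
  "doerfler_steps \<eta> \<theta> T =
    {l. \<theta> * (total_est \<eta> (T l))\<^sup>2 \<le> (est \<eta> (T l) (T l - T (Suc l)))\<^sup>2}"

definition axiom_quasi_orthogonality ::
  "('e set \<Rightarrow> 'e \<Rightarrow> real) \<Rightarrow> ('e set \<Rightarrow> 'e set \<Rightarrow> real) \<Rightarrow> real \<Rightarrow> (nat \<Rightarrow> 'e set) \<Rightarrow>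
   (real \<Rightarrow> real) \<Rightarrow> bool" where
  "axiom_quasi_orthogonality \<eta> d \<theta> T Corth \<longleftrightarrow>
    (let L = doerfler_steps \<eta> \<theta> T; S = (\<lambda>j. T (enumerate L j)) in
      \<forall>\<epsilon>>0. \<forall>n N. n \<le> N \<and> (infinite L \<or> Suc N < card L) \<longrightarrow>
        (\<Sum>j=n..N. (d (S (Suc j)) (S j))\<^sup>2 - \<epsilon> * (total_est \<eta> (S j))\<^sup>2)
          \<le> Corth \<epsilon> * (total_est \<eta> (S n))\<^sup>2)"

definition axiom_discrete_reliability ::
  "('e set \<Rightarrow> 'e set \<Rightarrow> 'e set) \<Rightarrow> 'e set \<Rightarrow> ('e set \<Rightarrow> 'e \<Rightarrow> real) \<Rightarrow> ('e set \<Rightarrow> 'e set \<Rightarrow> real) \<Rightarrow>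
   real \<Rightarrow> bool" where
  "axiom_discrete_reliability refine T0 \<eta> d Crel \<longleftrightarrow>
    (\<forall>T\<in>refinements refine T0. \<forall>T'\<in>refinements refine T. \<exists>R.
      T - T' \<subseteq> R \<and> R \<subseteq> T \<and> real (card R) \<le> Crel * real (card (T - T')) \<and>
      d T' T \<le> Crel * est \<eta> T R)"

locale adaptive_setting = mesh_refinement refine T0
  for refine :: "'e set \<Rightarrow> 'e set \<Rightarrow> 'e set" and T0 :: "'e set" +
  fixes \<eta> :: "problem \<Rightarrow> 'e set \<Rightarrow> 'e \<Rightarrow> real"
    and d :: "problem \<Rightarrow> 'e set \<Rightarrow> 'e set \<Rightarrow> real"
    and Cdist Cstb qred Cred :: real and Corth :: "real \<Rightarrow> real" and Crel :: real
    and \<theta> Cmark :: real and T M :: "nat \<Rightarrow> 'e set"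
  assumes estimator_nonneg: "T' \<in> refinements refine T0 \<Longrightarrow> x \<in> T' \<Longrightarrow> 0 \<le> \<eta> w T' x"
    and dist_nonneg:
      "T' \<in> refinements refine T0 \<Longrightarrow> T'' \<in> refinements refine T0 \<Longrightarrow> 0 \<le> d w T' T''"
    and dist_quasi_triangle:
      "T' \<in> refinements refine T0 \<Longrightarrow> T'' \<in> refinements refine T0 \<Longrightarrow>
       T''' \<in> refinements refine T0 \<Longrightarrow> inverse Cdist * d w T' T''' \<le> d w T' T'' + d w T'' T'''"
    and dist_quasi_symmetric:
      "T' \<in> refinements refine T0 \<Longrightarrow> T'' \<in> refinements refine T0 \<Longrightarrow>
       d w T' T'' \<le> Cdist * d w T'' T'"
    and run: "algorithm_run refine T0 \<eta> \<theta> Cmark T M"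
    and A1: "axiom_stability refine T0 (\<eta> w) (d w) Cstb"
    and A2: "axiom_reduction refine T0 (\<eta> w) (d w) qred Cred"
    and A3: "axiom_quasi_orthogonality (\<eta> w) (d w) \<theta> T Corth"
    and A4: "axiom_discrete_reliability refine T0 (\<eta> w) (d w) Crel"

definition linear_convergence ::
  "(problem \<Rightarrow> 'e set \<Rightarrow> 'e \<Rightarrow> real) \<Rightarrow> (nat \<Rightarrow> 'e set) \<Rightarrow> real \<Rightarrow> real \<Rightarrow> bool" where
  "linear_convergence \<eta> T Clin qlin \<longleftrightarrow>
    (\<forall>l n. total_est (\<eta> Primal) (T (l + n)) * total_est (\<eta> Dual) (T (l + n))
      \<le> Clin * qlin ^ n * (total_est (\<eta> Primal) (T l) * total_est (\<eta> Dual) (T l)))"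

definition meshes_upto :: "('e set \<Rightarrow> 'e set \<Rightarrow> 'e set) \<Rightarrow> 'e set \<Rightarrow> nat \<Rightarrow> 'e set set" where
  "meshes_upto refine T0 N =
    {T \<in> refinements refine T0. real (card T) - real (card T0) \<le> real N}"

text \<open>
  \<open>meshes_upto\<close> is finite whenever \<open>mesh_refinement\<close> and \<open>son_estimate\<close> hold, because every
  refinement step that changes the triangulation increases its cardinality; hence \<open>Min\<close> below is a
  genuine minimum.
\<close>

definition approx_seq ::
  "('e set \<Rightarrow> 'e set \<Rightarrow> 'e set) \<Rightarrow> 'e set \<Rightarrow> ('e set \<Rightarrow> 'e \<Rightarrow> real) \<Rightarrow> real \<Rightarrow> nat \<Rightarrow> real" where
  "approx_seq refine T0 \<eta> s N =
    (real N + 1) powr s * Min (total_est \<eta> ` meshes_upto refine T0 N)"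

text \<open>
  Membership in the approximation class is finiteness of the supremum; the real-valued
  \<open>approx_norm\<close> is meaningful only for members.
\<close>

definition in_approx_class ::
  "('e set \<Rightarrow> 'e set \<Rightarrow> 'e set) \<Rightarrow> 'e set \<Rightarrow> ('e set \<Rightarrow> 'e \<Rightarrow> real) \<Rightarrow> real \<Rightarrow> bool" where
  "in_approx_class refine T0 \<eta> s \<longleftrightarrow> bdd_above (range (approx_seq refine T0 \<eta> s))"

definition approx_norm ::
  "('e set \<Rightarrow> 'e set \<Rightarrow> 'e set) \<Rightarrow> 'e set \<Rightarrow> ('e set \<Rightarrow> 'e \<Rightarrow> real) \<Rightarrow> real \<Rightarrow> real" where
  "approx_norm refine T0 \<eta> s = (SUP N. approx_seq refine T0 \<eta> s N)"

end

theory Submission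
  imports Defs
begin

text \<open>
  Write \<open>\<eta>\<^sub>w\<close> for the estimator of the problem \<open>w\<close> and \<open>P\<close> for the product of the two estimators.

  Everything about a pair of a mesh and a refinement rests on one perturbation inequality
  (\<open>estimator_perturbation\<close>): stability controls the contribution of the common elements, reduction
  that of the new ones, both up to a multiple of the squared distance.  Bounding the distance by
  discrete reliability shows that refinement increases \<open>\<eta>\<^sub>w\<close> at most by a constant factor
  (\<open>quasi_monotone\<close>).  If the refined elements satisfy the Doerfler criterion, the inequality
  becomes a strict reduction up to the distance (\<open>estimator_reduction\<close>).

  Linear convergence: the marked set satisfies the Doerfler criterion for at least one of the two
  problems.  Along the steps where it does so for \<open>w\<close>, quasi-orthogonality lets the distances be
  summed, so the tails of \<open>\<Sum> \<eta>\<^sub>w\<^sup>2\<close> are bounded by their first terms, which forces geometric decay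
  (\<open>linear_decay_along_steps\<close>).  Between these steps \<open>\<eta>\<^sub>w\<close> is merely quasi-monotone.  But \<open>n\<close>
  consecutive steps contain together at least \<open>n\<close> good steps for the two problems, so the decay
  factors of the product \<open>P\<close> multiply to a full geometric factor.

  Optimal rate: if a refinement reduces \<open>\<eta>\<^sub>w\<^sup>2\<close> by a sufficiently small factor \<open>kappa\<close>, then the elements
  singled out by discrete reliability satisfy the Doerfler criterion for \<open>w\<close> (\<open>doerfler_optimal\<close>);
  this is where \<open>\<theta>\<close> has to be small.  Given the current mesh, overlay it with near-best meshes for
  the two problems, of a size chosen such that the product on the overlay is a small fraction of
  the current one.  Then at least one of the factors has dropped by \<open>kappa\<close>, and that problem has a
  Doerfler set whose cardinality is controlled by the approximation norms and a negative power of
  \<open>P\<close> (\<open>marking_bound\<close>).  The algorithm marks the smaller of the two quasi-minimal sets, so the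
  bound holds for the marked set no matter which problem it is.  The closure estimate sums these
  bounds over the history, and linear convergence makes the sum a geometric series dominated by
  its last term (\<open>cardinality_bound\<close>); solving for \<open>P\<close> gives the rate.

  The distance is only quasi-symmetric, while stability and discrete reliability use it in
  opposite orientations.  The threshold for \<open>\<theta>\<close> is therefore
  \<open>1 / (1 + Cstb\<^sup>2 (max 1 Cdist * Crel)\<^sup>2)\<close>, which is the usual one if \<open>Cdist \<le> 1\<close>.
\<close>

section \<open>Sequences and index sets\<close>

lemma young_square:
  fixes a b c :: real
  assumes "0 < c"
  shows "(a + b)\<^sup>2 \<le> (1 + c) * a\<^sup>2 + (1 + 1 / c) * b\<^sup>2"
proof -
  have "(1 + c) * a\<^sup>2 + (1 + 1 / c) * b\<^sup>2 - (a + b)\<^sup>2 = (c * a - b)\<^sup>2 / c"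
    using assms by (simp add: field_simps power2_eq_square)
  also have "\<dots> \<ge> 0"
    using assms by simp
  finally show ?thesis
    by simp
qed

lemma geometric_sum_le:
  fixes x :: real
  assumes "0 \<le> x" "x < 1"
  shows "(\<Sum>j<l. x ^ (l - j)) \<le> 1 / (1 - x)"
proof -
  have "(\<Sum>j<l. x ^ (l - j)) = (\<Sum>j<l. x ^ Suc j)"
    by (subst sum.nat_diff_reindex[symmetric]) (auto intro!: sum.cong)
  also have "\<dots> \<le> (\<Sum>j<l. x ^ j)"
    using assms by (intro sum_mono power_decreasing) auto
  also have "\<dots> = (1 - x ^ l) / (1 - x)"
    using assms by (simp add: sum_gp_strict)
  also have "\<dots> \<le> 1 / (1 - x)"
    using assms by (intro divide_right_mono) auto
  finally show ?thesis .
qed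

text \<open>
  The sum \<open>s n\<close> of the terms from \<open>n\<close> to \<open>m\<close> satisfies \<open>s (n + 1) = s n - e n \<le> (1 - 1 / A) * s n\<close>, so the
  tail sums contract; \<open>e m\<close> is the last of them and \<open>A * e n0\<close> bounds the first.
\<close>

lemma linear_decay_of_summable_tails:
  fixes e :: "nat \<Rightarrow> real"
  assumes A: "1 < A" and nonneg: "\<And>j. 0 \<le> e j"
    and tails: "\<And>n. n0 \<le> n \<Longrightarrow> n \<le> m \<Longrightarrow> (\<Sum>j=n..m. e j) \<le> A * e n"
    and "n0 \<le> m"
  shows "e m \<le> A * (1 - 1 / A) ^ (m - n0) * e n0"
proof -
  define s where "s n = (\<Sum>j=n..m. e j)" for n
  have contraction: "s (Suc n) \<le> (1 - 1 / A) * s n" if "n0 \<le> n" "n < m" for n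
  proof -
    have "s n = e n + s (Suc n)"
      unfolding s_def using that by (simp add: sum.atLeast_Suc_atMost)
    moreover have "s n / A \<le> e n"
      using tails[of n] that A by (simp add: s_def field_simps)
    ultimately have "s (Suc n) \<le> s n - s n / A"
      by linarith
    then show ?thesis
      by (simp add: left_diff_distrib)
  qed
  have "s (n0 + k) \<le> (1 - 1 / A) ^ k * s n0" if "n0 + k \<le> m" for k
    using that
  proof (induction k)
    case (Suc k)
    have "s (n0 + Suc k) \<le> (1 - 1 / A) * s (n0 + k)"
      using contraction[of "n0 + k"] Suc.prems by simp
    also have "\<dots> \<le> (1 - 1 / A) * ((1 - 1 / A) ^ k * s n0)"
      using Suc A by (intro mult_left_mono) auto
    finally show ?case
      by (simp add: mult.assoc)
  qed simp
  from this[of "m - n0"] have "s m \<le> (1 - 1 / A) ^ (m - n0) * s n0"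
    using \<open>n0 \<le> m\<close> by simp
  also have "\<dots> \<le> (1 - 1 / A) ^ (m - n0) * (A * e n0)"
    using tails[of n0] \<open>n0 \<le> m\<close> A by (intro mult_left_mono) (auto simp: s_def)
  finally show ?thesis
    by (simp add: s_def mult.assoc mult.left_commute)
qed

text \<open>
  Translates between the position of a step within a subsequence and its index in the whole
  sequence, for finite and infinite index sets alike.
\<close>

lemma enumerate_less_iff:
  fixes L :: "nat set"
  assumes i: "infinite L \<or> i < card L"
  shows "enumerate L i < m \<longleftrightarrow> i < card (L \<inter> {..<m})"
proof
  have strict: "enumerate L j < enumerate L k" if "j < k" "k \<le> i" for j k
    using i that by (cases "finite L") (auto intro: finite_enumerate_mono enumerate_mono)
  have mem: "enumerate L j \<in> L" if "j \<le> i" for j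
    using i that by (cases "finite L") (auto intro: finite_enumerate_in_set enumerate_in_set)
  have inj: "inj_on (enumerate L) {..i}"
    by (rule linorder_inj_onI') (use strict in force)
  {
    assume "enumerate L i < m"
    moreover have "enumerate L j \<le> enumerate L i" if "j \<le> i" for j
      using strict[of j i] that by (cases "j = i") auto
    ultimately have "enumerate L ` {..i} \<subseteq> L \<inter> {..<m}"
      using mem by (auto intro: le_less_trans)
    from card_mono[OF _ this] show "i < card (L \<inter> {..<m})"
      using inj by (simp add: card_image)
  next
    \<comment> \<open>otherwise all elements of \<open>L\<close> below \<open>m\<close> are among the first \<open>i\<close>\<close>
    assume less: "i < card (L \<inter> {..<m})"
    show "enumerate L i < m"
    proof (rule ccontr)
      assume ge: "\<not> enumerate L i < m"
      have "L \<inter> {..<m} \<subseteq> enumerate L ` {..<i}"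
      proof
        fix x assume x: "x \<in> L \<inter> {..<m}"
        obtain j where j: "infinite L \<or> j < card L" "enumerate L j = x"
          using x by (cases "finite L") (auto dest: finite_enumerate_Ex enumerate_Ex)
        have "j < i"
        proof (rule ccontr)
          assume "\<not> j < i"
          then consider "i = j" | "i < j"
            by linarith
          then have "enumerate L i \<le> enumerate L j"
          proof cases
            case 2
            then show ?thesis
              using j(1)
              by (cases "finite L") (auto intro: less_imp_le finite_enumerate_mono enumerate_mono)
          qed simp
          with j(2) x ge show False
            by auto
        qed
        with j(2) show "x \<in> enumerate L ` {..<i}"
          by auto
      qed
      from card_mono[OF _ this] card_image_le[of "{..<i}" "enumerate L"] less
      show False
        by simp
    qed
  }
qed

section \<open>Refinements\<close>

lemma refinements_trans:
  assumes "T'' \<in> refinements refine T'" "T' \<in> refinements refine T"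
  shows "T'' \<in> refinements refine T"
  using assms by (induction rule: refinements.induct) (auto intro: refinements.step)

lemma est_power2: "(est \<eta> T U)\<^sup>2 = (\<Sum>x\<in>U. (\<eta> T x)\<^sup>2)"
  by (simp add: est_def L2_set_def sum_nonneg)

lemma est_nonneg: "0 \<le> est \<eta> T U"
  by (simp add: est_def)

lemma total_est_nonneg: "0 \<le> total_est \<eta> T"
  by (simp add: total_est_def est_nonneg)

lemma est_power2_mono:
  assumes "finite V" "U \<subseteq> V"
  shows "(est \<eta> T U)\<^sup>2 \<le> (est \<eta> T V)\<^sup>2"
  using assms by (auto simp: est_power2 intro!: sum_mono2)

lemma est_power2_split:
  assumes "finite V"
  shows "(est \<eta> T V)\<^sup>2 = (est \<eta> T (V \<inter> W))\<^sup>2 + (est \<eta> T (V - W))\<^sup>2"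
  unfolding est_power2 using assms by (subst sum.Int_Diff[of V _ W]) auto

context mesh_refinement
begin

lemma marked_refined:
  assumes "T \<in> refinements refine T0" "M \<subseteq> T"
  shows "M \<subseteq> T - refine T M"
  using coarsest[OF assms, of "refine T M"] assms
  by (auto intro: refinements.intros)

text \<open>
  Let \<open>D\<close> be the set of all elements that disappear from \<open>T\<close>, marked or not.  By \<open>coarsest\<close>, \<open>refine T M\<close>
  refines \<open>refine T D\<close>, hence so does \<open>T'\<close>; and then \<open>T'\<close> contains no element of \<open>D\<close>, again by
  \<open>coarsest\<close>.
\<close>

lemma refined_never_reappears:
  assumes T: "T \<in> refinements refine T0" and M: "M \<subseteq> T"
    and T': "T' \<in> refinements refine (refine T M)"
  shows "T - refine T M \<subseteq> T - T'"
proof -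
  let ?M = "T - refine T M"
  have step: "refine T M \<in> refinements refine T"
    using M by (intro refinements.intros)
  have "refine T M \<in> refinements refine (refine T ?M)"
    using coarsest[OF T _ step, of ?M] by blast
  with T' have "T' \<in> refinements refine (refine T ?M)"
    by (rule refinements_trans)
  then have "?M \<inter> T' = {}"
    using coarsest[OF T, of ?M T'] refinements_trans[OF T' step] by blast
  then show ?thesis
    by blast
qed

lemma card_refinement_le:
  assumes "son_estimate refine T0" "T \<in> refinements refine T0" "T' \<in> refinements refine T"
  shows "card (T - T') + card T \<le> card T'"
  using assms by (auto simp: son_estimate_def)

text \<open>
  By \<open>coarsest\<close> with no marked elements, \<open>T\<close> and \<open>refine T {}\<close> are refinements of each other, and the
  son estimate in both directions leaves no room for a difference.
\<close>

lemma refine_empty: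
  assumes son: "son_estimate refine T0" and T: "T \<in> refinements refine T0"
  shows "refine T {} = T"
proof -
  have forth: "refine T {} \<in> refinements refine T"
    by (rule refinements.step[OF refinements.base]) simp
  have coarse: "T \<in> refinements refine (refine T {})"
    using coarsest[OF T, of "{}" T] by (auto intro: refinements.base)
  have adm: "refine T {} \<in> refinements refine T0"
    using refinements_trans[OF forth T] .
  have "card (T - refine T {}) = 0" "card (refine T {} - T) = 0"
    using card_refinement_le[OF son T forth] card_refinement_le[OF son adm coarse] by auto
  then show ?thesis
    using finite_mesh[OF T] finite_mesh[OF adm] by auto
qed

text \<open>
  A step with a nonempty marked set strictly increases the cardinality and a mesh has only finitely
  many subsets to mark, so the meshes of bounded size are found in finitely many rounds.  The
  finiteness makes the minimum in \<open>approx_seq\<close> an attained one.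
\<close>

lemma finite_meshes_card_le:
  assumes son: "son_estimate refine T0"
  shows "finite {T \<in> refinements refine T0. card T \<le> n}"
proof (induction n)
  case 0
  have "{T \<in> refinements refine T0. card T \<le> 0} \<subseteq> {{}}"
    using finite_mesh by auto
  then show ?case
    by (rule finite_subset) simp
next
  case (Suc n)
  let ?F = "{T \<in> refinements refine T0. card T \<le> n}"
  have "T \<in> insert T0 (\<Union>T\<in>?F. refine T ` Pow T)"
    if "T \<in> refinements refine T0" "card T \<le> Suc n" for T
    using that
  proof (induction rule: refinements.induct)
    case (step T' M)
    show ?case
    proof (cases "M = {}")
      case True
      then show ?thesis
        using step refine_empty[OF son step.hyps(1)] by simp
    next
      case False
      have "refine T' M \<in> refinements refine T'"
        using step.hyps by (intro refinements.intros)
      from card_refinement_le[OF son step.hyps(1) this]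
      have "card (T' - refine T' M) + card T' \<le> Suc n"
        using step.prems by simp
      moreover have "0 < card (T' - refine T' M)"
        using False marked_refined[OF step.hyps] finite_mesh[OF step.hyps(1)]
        by (auto simp: card_gt_0_iff)
      ultimately show ?thesis
        using step.hyps by auto
    qed
  qed simp
  then have "{T \<in> refinements refine T0. card T \<le> Suc n} \<subseteq> insert T0 (\<Union>T\<in>?F. refine T ` Pow T)"
    by blast
  moreover have "finite (insert T0 (\<Union>T\<in>?F. refine T ` Pow T))"
    using Suc finite_mesh by auto
  ultimately show ?case
    by (rule finite_subset)
qed

lemma finite_meshes_upto:
  assumes "son_estimate refine T0"
  shows "finite (meshes_upto refine T0 N)"
proof -
  have "meshes_upto refine T0 N \<subseteq> {T \<in> refinements refine T0. card T \<le> card T0 + N}"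
    by (auto simp: meshes_upto_def)
  then show ?thesis
    using finite_meshes_card_le[OF assms] by (rule finite_subset)
qed

lemma approx_seq_attained:
  assumes "son_estimate refine T0"
  obtains T where "T \<in> meshes_upto refine T0 N"
    "approx_seq refine T0 \<eta> s N = (real N + 1) powr s * total_est \<eta> T"
proof -
  have "T0 \<in> meshes_upto refine T0 N"
    by (simp add: meshes_upto_def refinements.base)
  then have "Min (total_est \<eta> ` meshes_upto refine T0 N) \<in> total_est \<eta> ` meshes_upto refine T0 N"
    using finite_meshes_upto[OF assms] by (intro Min_in) auto
  then show ?thesis
    using that by (auto simp: approx_seq_def)
qed

lemma approx_norm_nonneg:
  assumes "son_estimate refine T0" "in_approx_class refine T0 \<eta> s"
  shows "0 \<le> approx_norm refine T0 \<eta> s"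
proof -
  obtain T where T: "approx_seq refine T0 \<eta> s 0 = (real 0 + 1) powr s * total_est \<eta> T"
    using approx_seq_attained[OF assms(1)] by metis
  have "0 \<le> approx_seq refine T0 \<eta> s 0"
    unfolding T by (simp add: total_est_nonneg)
  also have "\<dots> \<le> approx_norm refine T0 \<eta> s"
    unfolding approx_norm_def using assms(2)
    by (intro cSUP_upper) (auto simp: in_approx_class_def)
  finally show ?thesis .
qed

lemma approx_class_mesh:
  assumes "son_estimate refine T0" "in_approx_class refine T0 \<eta> s"
  obtains T where "T \<in> refinements refine T0" "real (card T) \<le> real (card T0) + real N"
    "(real N + 1) powr s * total_est \<eta> T \<le> approx_norm refine T0 \<eta> s"
proof -
  obtain T where T: "T \<in> meshes_upto refine T0 N"
    "approx_seq refine T0 \<eta> s N = (real N + 1) powr s * total_est \<eta> T"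
    using approx_seq_attained[OF assms(1)] by metis
  have "approx_seq refine T0 \<eta> s N \<le> approx_norm refine T0 \<eta> s"
    unfolding approx_norm_def using assms(2)
    by (intro cSUP_upper) (auto simp: in_approx_class_def)
  with T show ?thesis
    using that by (auto simp: meshes_upto_def)
qed

end

section \<open>Constants\<close>

text \<open>
  The constants of the proof must be the same for all runs of the algorithm, so they live in a
  locale that knows the parameters of the axioms but neither meshes nor estimators.
\<close>

locale adaptivity_constants =
  fixes Cdist Cstb qred Cred :: real and Corth :: "real \<Rightarrow> real" and Crel \<theta> :: real
  assumes Cstb_pos: "0 < Cstb" and qred_pos: "0 < qred" and qred_less: "qred < 1" and Cred_pos: "0 < Cred"
    and Corth_pos: "\<And>\<epsilon>. 0 < \<epsilon> \<Longrightarrow> 0 < Corth \<epsilon>" and Crel_pos: "0 < Crel"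
    and theta_pos: "0 < \<theta>"
    and theta_less: "\<theta> * (1 + Cstb\<^sup>2 * (max 1 Cdist * Crel)\<^sup>2) < 1"
begin

text \<open>
  \<open>Csym\<close> pays for swapping the arguments of the distance, and \<open>Cdrel\<close> is the discrete reliability
  constant after such a swap.  \<open>Cmon\<close> is the quasi-monotonicity constant for squared estimators.
\<close>

definition Csym where "Csym = max 1 Cdist"

definition Cdrel where "Cdrel = Csym * Crel"

definition Cmon where "Cmon = 2 + (2 * Cstb\<^sup>2 + Cred) * Cdrel\<^sup>2"

text \<open>
  A Doerfler step multiplies the squared estimator by \<open>1 - gap\<close>, up to \<open>Cest\<close> times the squared distance.
  Quasi-orthogonality is applied with the parameter \<open>gap / (2 * Cest)\<close>, so that it costs half of \<open>gap\<close>; the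
  remaining half is the denominator of \<open>Csum\<close>.
\<close>

definition gap where "gap = (1 - qred) * \<theta> / 2"

definition Cest where "Cest = ((1 + 1 / gap) * Cstb\<^sup>2 + Cred) * Csym\<^sup>2"

definition Csum where "Csum = (1 + Cest * Corth (gap / (2 * Cest))) / (gap / 2)"

definition Clin where "Clin = Cmon\<^sup>2 * Csum / (1 - 1 / Csum)"

definition qlin where "qlin = sqrt (1 - 1 / Csum)"

text \<open>
  With \<open>B = Cstb\<^sup>2 * Cdrel\<^sup>2\<close>, the smallness of \<open>\<theta>\<close> leaves \<open>1 - \<theta> * (1 + B) = 2 * slack\<close> to be spent: one
  half on Young's inequality, whose weight enlarges \<open>\<theta> * B\<close> by \<open>slack\<close>, and the other half on the
  estimator of the refined mesh, whose contribution \<open>kappa\<close> limits to \<open>slack\<close>.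
\<close>

definition slack where "slack = (1 - \<theta> * (1 + Cstb\<^sup>2 * Cdrel\<^sup>2)) / 2"

definition young_weight where "young_weight = slack / (\<theta> * (Cstb\<^sup>2 * Cdrel\<^sup>2))"

definition kappa where "kappa = slack / (1 + 1 / young_weight)"

lemma theta_less_1: "\<theta> < 1"
proof -
  have "\<theta> * 1 \<le> \<theta> * (1 + Cstb\<^sup>2 * (max 1 Cdist * Crel)\<^sup>2)"
    using theta_pos by (intro mult_left_mono) auto
  with theta_less show ?thesis
    by simp
qed

lemma Csym_ge_1: "1 \<le> Csym"
  by (simp add: Csym_def)

lemma Cdrel_pos: "0 < Cdrel"
  using Csym_ge_1 Crel_pos by (simp add: Cdrel_def)

lemma Cmon_ge_1: "1 \<le> Cmon"
proof -
  have "0 \<le> (2 * Cstb\<^sup>2 + Cred) * Cdrel\<^sup>2"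
    using Cred_pos by simp
  then show ?thesis
    unfolding Cmon_def by linarith
qed

lemma gap_pos: "0 < gap"
  using qred_less theta_pos by (simp add: gap_def)

lemma Cest_pos: "0 < Cest"
  unfolding Cest_def using gap_pos Cred_pos Csym_ge_1
  by (intro mult_pos_pos add_nonneg_pos) auto

lemma gap_le_half: "gap \<le> 1 / 2"
  using mult_mono[of "1 - qred" 1 \<theta> 1] theta_less_1 theta_pos qred_pos qred_less
  by (simp add: gap_def)

lemma Csum_gt_1: "1 < Csum"
proof -
  have "0 < Cest * Corth (gap / (2 * Cest))"
    using Cest_pos gap_pos Corth_pos by simp
  then show ?thesis
    using gap_pos gap_le_half by (simp add: Csum_def field_simps)
qed

lemma rho_bounds: "0 < 1 - 1 / Csum" "1 - 1 / Csum < 1"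
  using Csum_gt_1 by (simp_all add: field_simps)

lemma qlin_bounds: "0 < qlin" "qlin < 1"
  using rho_bounds by (simp_all add: qlin_def)

lemma Clin_pos: "0 < Clin"
  using Cmon_ge_1 Csum_gt_1 rho_bounds by (simp add: Clin_def)

lemma slack_pos: "0 < slack"
  using theta_less by (simp add: slack_def Cdrel_def Csym_def)

lemma young_weight_pos: "0 < young_weight"
  using slack_pos theta_pos Cdrel_pos Cstb_pos by (simp add: young_weight_def)

lemma kappa_pos: "0 < kappa"
  unfolding kappa_def using slack_pos young_weight_pos
  by (intro divide_pos_pos add_pos_pos) auto

end

section \<open>Perturbation of the estimator under refinement\<close>

locale adaptive_run =
  adaptive_setting refine T0 \<eta> d Cdist Cstb qred Cred Corth Crel \<theta> Cmark T M +
  adaptivity_constants Cdist Cstb qred Cred Corth Crel \<theta>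
  for refine :: "'e set \<Rightarrow> 'e set \<Rightarrow> 'e set" and T0 \<eta> d Cdist Cstb qred Cred Corth Crel \<theta> Cmark T M
begin

abbreviation adm :: "'e set set" where "adm \<equiv> refinements refine T0"

abbreviation tot :: "problem \<Rightarrow> 'e set \<Rightarrow> real" where "tot w \<equiv> total_est (\<eta> w)"

lemma dist_symmetric_le:
  assumes "T' \<in> adm" "T'' \<in> adm"
  shows "d w T' T'' \<le> Csym * d w T'' T'"
proof -
  have "Cdist * d w T'' T' \<le> Csym * d w T'' T'"
    using dist_nonneg[OF assms(2,1)] by (intro mult_right_mono) (auto simp: Csym_def)
  with dist_quasi_symmetric[OF assms] show ?thesis
    by (rule order_trans)
qed

lemma discrete_reliability:
  assumes T': "T' \<in> adm" and T'': "T'' \<in> refinements refine T'"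
  obtains R where "T' - T'' \<subseteq> R" "R \<subseteq> T'" "real (card R) \<le> Crel * real (card (T' - T''))"
    "d w T' T'' \<le> Cdrel * est (\<eta> w) T' R"
proof -
  obtain R where R: "T' - T'' \<subseteq> R" "R \<subseteq> T'" "real (card R) \<le> Crel * real (card (T' - T''))"
    "d w T'' T' \<le> Crel * est (\<eta> w) T' R"
    using A4[of w] assms unfolding axiom_discrete_reliability_def by blast
  have "d w T' T'' \<le> Csym * d w T'' T'"
    using dist_symmetric_le[OF T' refinements_trans[OF T'' T']] .
  also have "\<dots> \<le> Csym * (Crel * est (\<eta> w) T' R)"
    using R(4) Csym_ge_1 by (intro mult_left_mono) auto
  finally have "d w T' T'' \<le> Cdrel * est (\<eta> w) T' R"
    by (simp add: Cdrel_def mult.assoc)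
  with R that show ?thesis
    by blast
qed

text \<open>
  The weight \<open>c\<close> is free: \<open>c = 1\<close> suffices for quasi-monotonicity, and a small one keeps the
  reduction of the refined elements visible.
\<close>

lemma estimator_perturbation:
  assumes T': "T' \<in> adm" and T'': "T'' \<in> refinements refine T'" and c: "0 < c"
  shows "(tot w T'')\<^sup>2 \<le> (1 + c) * (est (\<eta> w) T' (T' \<inter> T''))\<^sup>2
    + qred * (est (\<eta> w) T' (T' - T''))\<^sup>2 + ((1 + 1 / c) * Cstb\<^sup>2 + Cred) * (d w T' T'')\<^sup>2"
proof -
  have adm: "T'' \<in> adm"
    using refinements_trans[OF T'' T'] .
  have "est (\<eta> w) T'' (T' \<inter> T'') \<le> est (\<eta> w) T' (T' \<inter> T'') + Cstb * d w T' T''"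
    using A1[of w] T' T'' unfolding axiom_stability_def by (auto simp: abs_le_iff algebra_simps)
  then have "(est (\<eta> w) T'' (T' \<inter> T''))\<^sup>2 \<le> (est (\<eta> w) T' (T' \<inter> T'') + Cstb * d w T' T'')\<^sup>2"
    by (intro power_mono est_nonneg)
  also have "\<dots> \<le> (1 + c) * (est (\<eta> w) T' (T' \<inter> T''))\<^sup>2 + (1 + 1 / c) * (Cstb * d w T' T'')\<^sup>2"
    using c by (rule young_square)
  finally have "(est (\<eta> w) T'' (T'' \<inter> T'))\<^sup>2 \<le> (1 + c) * (est (\<eta> w) T' (T' \<inter> T''))\<^sup>2
      + (1 + 1 / c) * Cstb\<^sup>2 * (d w T' T'')\<^sup>2"
    by (simp add: power_mult_distrib Int_commute mult.assoc)
  moreover have "(est (\<eta> w) T'' (T'' - T'))\<^sup>2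
      \<le> qred * (est (\<eta> w) T' (T' - T''))\<^sup>2 + Cred * (d w T' T'')\<^sup>2"
    using A2[of w] T' T'' unfolding axiom_reduction_def by blast
  moreover have "(tot w T'')\<^sup>2 = (est (\<eta> w) T'' (T'' \<inter> T'))\<^sup>2 + (est (\<eta> w) T'' (T'' - T'))\<^sup>2"
    unfolding total_est_def by (rule est_power2_split[OF finite_mesh[OF adm]])
  ultimately show ?thesis
    by (simp add: algebra_simps)
qed

lemma quasi_monotone:
  assumes T': "T' \<in> adm" and T'': "T'' \<in> refinements refine T'"
  shows "(tot w T'')\<^sup>2 \<le> Cmon * (tot w T')\<^sup>2"
proof -
  obtain R where R: "R \<subseteq> T'" "d w T' T'' \<le> Cdrel * est (\<eta> w) T' R"
    using discrete_reliability[OF assms] by metis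
  have dnn: "0 \<le> d w T' T''"
    using dist_nonneg[OF T' refinements_trans[OF T'' T']] .
  have "(d w T' T'')\<^sup>2 \<le> (Cdrel * est (\<eta> w) T' R)\<^sup>2"
    using R(2) dnn by (rule power_mono)
  also have "\<dots> \<le> Cdrel\<^sup>2 * (tot w T')\<^sup>2"
    unfolding power_mult_distrib total_est_def
    using est_power2_mono[OF finite_mesh[OF T'] R(1), of "\<eta> w" T'] by (intro mult_left_mono) auto
  finally have dist: "(d w T' T'')\<^sup>2 \<le> Cdrel\<^sup>2 * (tot w T')\<^sup>2" .
  have split: "(tot w T')\<^sup>2 = (est (\<eta> w) T' (T' \<inter> T''))\<^sup>2 + (est (\<eta> w) T' (T' - T''))\<^sup>2"
    unfolding total_est_def by (rule est_power2_split[OF finite_mesh[OF T']])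
  have "(tot w T'')\<^sup>2 \<le> 2 * (est (\<eta> w) T' (T' \<inter> T''))\<^sup>2
      + qred * (est (\<eta> w) T' (T' - T''))\<^sup>2 + (2 * Cstb\<^sup>2 + Cred) * (d w T' T'')\<^sup>2"
    using estimator_perturbation[OF assms, of 1 w] by simp
  also have "\<dots> \<le> 2 * (est (\<eta> w) T' (T' \<inter> T''))\<^sup>2
      + 2 * (est (\<eta> w) T' (T' - T''))\<^sup>2 + (2 * Cstb\<^sup>2 + Cred) * (Cdrel\<^sup>2 * (tot w T')\<^sup>2)"
    using qred_less Cred_pos dist by (intro add_mono mult_left_mono mult_right_mono) auto
  also have "\<dots> = Cmon * (tot w T')\<^sup>2"
    unfolding Cmon_def split by (simp add: algebra_simps)
  finally show ?thesis .
qed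

text \<open>
  The refined elements enter with the factor \<open>qred < 1\<close> and carry at least the share \<open>\<theta>\<close> of the
  estimator, which saves \<open>(1 - qred) * \<theta> = 2 * gap\<close>; Young's inequality with weight \<open>gap\<close> gives back
  one half of this.
\<close>

lemma estimator_reduction:
  assumes T': "T' \<in> adm" and T'': "T'' \<in> refinements refine T'"
    and marked: "\<theta> * (tot w T')\<^sup>2 \<le> (est (\<eta> w) T' (T' - T''))\<^sup>2"
  shows "(tot w T'')\<^sup>2 \<le> (1 - gap) * (tot w T')\<^sup>2 + Cest * (d w T'' T')\<^sup>2"
proof -
  let ?K = "(1 + 1 / gap) * Cstb\<^sup>2 + Cred"
  have adm: "T'' \<in> adm"
    using refinements_trans[OF T'' T'] .
  have K: "0 \<le> ?K"
    using gap_pos Cred_pos by simp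
  have "(d w T' T'')\<^sup>2 \<le> (Csym * d w T'' T')\<^sup>2"
    using dist_symmetric_le[OF T' adm] dist_nonneg[OF T' adm] by (rule power_mono)
  then have "?K * (d w T' T'')\<^sup>2 \<le> ?K * (Csym * d w T'' T')\<^sup>2"
    using K by (rule mult_left_mono)
  then have dist: "?K * (d w T' T'')\<^sup>2 \<le> Cest * (d w T'' T')\<^sup>2"
    by (simp only: Cest_def power_mult_distrib mult.assoc)
  have split: "(tot w T')\<^sup>2 = (est (\<eta> w) T' (T' \<inter> T''))\<^sup>2 + (est (\<eta> w) T' (T' - T''))\<^sup>2"
    unfolding total_est_def by (rule est_power2_split[OF finite_mesh[OF T']])
  have "(1 + gap) * (est (\<eta> w) T' (T' \<inter> T''))\<^sup>2 + qred * (est (\<eta> w) T' (T' - T''))\<^sup>2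
      = (1 + gap) * (tot w T')\<^sup>2 - (1 + gap - qred) * (est (\<eta> w) T' (T' - T''))\<^sup>2"
    unfolding split by (simp add: algebra_simps)
  also have "\<dots> \<le> (1 + gap) * (tot w T')\<^sup>2 - (1 - qred) * (\<theta> * (tot w T')\<^sup>2)"
  proof -
    have "(1 - qred) * (\<theta> * (tot w T')\<^sup>2) \<le> (1 + gap - qred) * (est (\<eta> w) T' (T' - T''))\<^sup>2"
      using marked gap_pos qred_less theta_pos by (intro mult_mono) auto
    then show ?thesis
      by linarith
  qed
  also have "\<dots> = (1 - gap) * (tot w T')\<^sup>2"
    unfolding gap_def by (simp add: field_simps)
  finally show ?thesis
    using estimator_perturbation[OF T' T'' gap_pos, of w] dist by linarith
qed

section \<open>Linear convergence\<close>

lemma run_step: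
  obtains Mw :: "problem \<Rightarrow> 'e set" where
    "\<And>w. doerfler (\<eta> w) \<theta> (T l) (Mw w)"
    "\<And>w U. doerfler (\<eta> w) \<theta> (T l) U \<Longrightarrow> real (card (Mw w)) \<le> Cmark * real (card U)"
    "M l \<in> {Mw Primal, Mw Dual}" "card (M l) = min (card (Mw Primal)) (card (Mw Dual))"
    "T (Suc l) = refine (T l) (M l)"
  using run unfolding algorithm_run_def by metis

lemma marked_subset: "M l \<subseteq> T l"
proof -
  obtain w where "doerfler (\<eta> w) \<theta> (T l) (M l)"
    by (rule run_step[of l]) (metis insertE singletonD)
  then show ?thesis
    by (simp add: doerfler_def)
qed

lemma run_Suc: "T (Suc l) = refine (T l) (M l)"
  by (rule run_step[of l])

lemma run_refinement: "T (l + n) \<in> refinements refine (T l)"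
  by (induction n) (simp_all add: run_Suc refinements.intros marked_subset)

lemma run_refinement_le: "l \<le> m \<Longrightarrow> T m \<in> refinements refine (T l)"
  using run_refinement[of l "m - l"] by simp

lemma run_adm: "T l \<in> adm"
  using run_refinement[of 0 l] run by (simp add: algorithm_run_def)

abbreviation steps :: "problem \<Rightarrow> nat set" where "steps w \<equiv> doerfler_steps (\<eta> w) \<theta> T"

text \<open>
  The marked set is one of the two Doerfler sets, and all its elements are refined.
\<close>

lemma step_for_some_problem: "l \<in> steps Primal \<union> steps Dual"
proof -
  obtain w where w: "doerfler (\<eta> w) \<theta> (T l) (M l)"
    by (rule run_step[of l]) (metis insertE singletonD)
  have "M l \<subseteq> T l - T (Suc l)"
    unfolding run_Suc by (rule marked_refined[OF run_adm marked_subset])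
  from est_power2_mono[OF _ this, of "\<eta> w" "T l"] w have "l \<in> steps w"
    using finite_mesh[OF run_adm] by (auto simp: doerfler_def doerfler_steps_def)
  then show ?thesis
    by (cases w) auto
qed

text \<open>
  Consecutive members of the subsequence of Doerfler steps need not be consecutive meshes.  The reduction
  nevertheless reaches any later mesh, because the elements refined in step \<open>l\<close> stay refined.
\<close>

lemma reduction_after_step:
  assumes l: "l \<in> steps w" and "l < m"
  shows "(tot w (T m))\<^sup>2 \<le> (1 - gap) * (tot w (T l))\<^sup>2 + Cest * (d w (T m) (T l))\<^sup>2"
proof (rule estimator_reduction[OF run_adm run_refinement_le])
  have "T m \<in> refinements refine (refine (T l) (M l))"
    using run_refinement_le[of "Suc l" m] \<open>l < m\<close> by (simp add: run_Suc)
  from refined_never_reappears[OF run_adm marked_subset this]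
  have "(est (\<eta> w) (T l) (T l - T (Suc l)))\<^sup>2 \<le> (est (\<eta> w) (T l) (T l - T m))\<^sup>2"
    using finite_mesh[OF run_adm] by (intro est_power2_mono) (auto simp: run_Suc)
  with l show "\<theta> * (tot w (T l))\<^sup>2 \<le> (est (\<eta> w) (T l) (T l - T m))\<^sup>2"
    by (simp add: doerfler_steps_def)
qed (use \<open>l < m\<close> in simp)

text \<open>
  Summing the estimator reduction over the subsequence and absorbing the distances by
  quasi-orthogonality bounds the shifted sum by \<open>1 - gap / 2\<close> times the sum itself, up to a multiple
  of the first term.
\<close>

lemma summable_tails_of_steps:
  assumes valid: "infinite (steps w) \<or> m < card (steps w)" and "n \<le> m"
  shows "(\<Sum>j=n..m. (tot w (T (enumerate (steps w) j)))\<^sup>2)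
    \<le> Csum * (tot w (T (enumerate (steps w) n)))\<^sup>2"
proof -
  let ?L = "steps w"
  define S where "S j = T (enumerate ?L j)" for j
  define e where "e j = (tot w (S j))\<^sup>2" for j
  define \<epsilon> where "\<epsilon> = gap / (2 * Cest)"
  have e_nonneg: "0 \<le> e j" for j
    by (simp add: e_def)
  have eps: "0 < \<epsilon>" "Cest * \<epsilon> = gap / 2"
    using gap_pos Cest_pos by (simp_all add: \<epsilon>_def)
  have C: "0 < Cest * Corth \<epsilon>"
    using Cest_pos Corth_pos[OF eps(1)] by simp
  have "(\<Sum>j=n..m. e j) * (gap / 2) \<le> (1 + Cest * Corth \<epsilon>) * e n"
  proof (cases "n = m")
    case True
    have "gap / 2 * e n \<le> (1 + Cest * Corth \<epsilon>) * e n"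
      using C e_nonneg gap_le_half by (intro mult_right_mono) auto
    with True show ?thesis
      by (simp add: mult.commute)
  next
    case False
    with \<open>n \<le> m\<close> obtain N where N: "m = Suc N" "n \<le> N"
      by (cases m) auto
    have reduction: "e (Suc j) \<le> (1 - gap) * e j + Cest * (d w (S (Suc j)) (S j))\<^sup>2"
      if "j \<le> N" for j
    proof -
      have "infinite ?L \<or> Suc j < card ?L"
        using valid N that by auto
      then have "enumerate ?L j \<in> ?L" "enumerate ?L j < enumerate ?L (Suc j)"
        by (cases "finite ?L";
            simp add: finite_enumerate_in_set enumerate_in_set finite_enumerate_step enumerate_step)+
      then show ?thesis
        unfolding e_def S_def by (rule reduction_after_step)
    qed
    have "(\<Sum>j=n..N. (d w (S (Suc j)) (S j))\<^sup>2 - \<epsilon> * e j) \<le> Corth \<epsilon> * e n"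
      using A3[of w] valid N eps(1)
      unfolding axiom_quasi_orthogonality_def Let_def e_def S_def by auto
    then have "(\<Sum>j=n..N. (d w (S (Suc j)) (S j))\<^sup>2) \<le> Corth \<epsilon> * e n + \<epsilon> * (\<Sum>j=n..N. e j)"
      by (simp add: sum_subtractf sum_distrib_left)
    then have "Cest * (\<Sum>j=n..N. (d w (S (Suc j)) (S j))\<^sup>2)
        \<le> Cest * (Corth \<epsilon> * e n + \<epsilon> * (\<Sum>j=n..N. e j))"
      using Cest_pos by (intro mult_left_mono) auto
    also have "\<dots> = Cest * Corth \<epsilon> * e n + gap / 2 * (\<Sum>j=n..N. e j)"
      by (simp add: distrib_left mult.assoc flip: eps(2))
    finally have orth: "Cest * (\<Sum>j=n..N. (d w (S (Suc j)) (S j))\<^sup>2)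
        \<le> Cest * Corth \<epsilon> * e n + gap / 2 * (\<Sum>j=n..N. e j)" .
    have "(\<Sum>j=n..N. e (Suc j))
        \<le> (\<Sum>j=n..N. (1 - gap) * e j + Cest * (d w (S (Suc j)) (S j))\<^sup>2)"
      by (intro sum_mono reduction) auto
    also have "\<dots> \<le> (1 - gap) * (\<Sum>j=n..N. e j) + (Cest * Corth \<epsilon> * e n + gap / 2 * (\<Sum>j=n..N. e j))"
      using orth by (simp add: sum.distrib sum_distrib_left)
    also have "\<dots> = (1 - gap / 2) * (\<Sum>j=n..N. e j) + Cest * Corth \<epsilon> * e n"
      by (simp add: algebra_simps)
    finally have shifted: "(\<Sum>j=n..N. e (Suc j))
        \<le> (1 - gap / 2) * (\<Sum>j=n..N. e j) + Cest * Corth \<epsilon> * e n" .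
    have head: "(\<Sum>j=n..m. e j) = e n + (\<Sum>j=n..N. e (Suc j))"
      using N by (simp add: sum.atLeast_Suc_atMost sum.shift_bounds_cl_Suc_ivl del: sum.cl_ivl_Suc)
    have last: "(\<Sum>j=n..m. e j) = (\<Sum>j=n..N. e j) + e m"
      using N by simp
    have "(1 - gap / 2) * (\<Sum>j=n..N. e j) \<le> (1 - gap / 2) * (\<Sum>j=n..m. e j)"
      unfolding last using e_nonneg gap_le_half by (intro mult_left_mono) auto
    with shifted head show ?thesis
      by (simp add: algebra_simps)
  qed
  then have "(\<Sum>j=n..m. e j) \<le> (1 + Cest * Corth \<epsilon>) * e n / (gap / 2)"
    using gap_pos by (subst pos_le_divide_eq) auto
  then show ?thesis
    by (simp only: Csum_def e_def S_def \<epsilon>_def times_divide_eq_left)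
qed

text \<open>
  The Doerfler steps between \<open>l\<close> and \<open>m\<close> give geometric decay from the first to the last of them;
  quasi-monotonicity bridges the gaps at both ends.  These \<open>k\<close> steps have only \<open>k - 1\<close> transitions,
  which explains the division by \<open>1 - 1 / Csum\<close> in \<open>Clin\<close>.
\<close>

lemma linear_decay_along_steps:
  assumes "l \<le> m"
  shows "(tot w (T m))\<^sup>2 \<le> Clin * (1 - 1 / Csum) ^ card (steps w \<inter> {l..<m}) * (tot w (T l))\<^sup>2"
proof -
  let ?L = "steps w"
  let ?\<rho> = "1 - 1 / Csum"
  define a where "a = card (?L \<inter> {..<l})"
  define k where "k = card (?L \<inter> {l..<m})"
  have ak: "card (?L \<inter> {..<m}) = a + k"
    unfolding a_def k_def using \<open>l \<le> m\<close>
    by (subst card_Un_disjoint[symmetric]) (auto intro!: arg_cong[where f = card])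
  have mono: "(tot w (T j))\<^sup>2 \<le> Cmon * (tot w (T i))\<^sup>2" if "i \<le> j" for i j
    using quasi_monotone[OF run_adm run_refinement_le[OF that]] .
  have C: "Cmon \<le> Cmon\<^sup>2 * Csum / ?\<rho>"
  proof -
    have "1 \<le> Csum / ?\<rho>"
      using rho_bounds Csum_gt_1 by (simp only: pos_le_divide_eq mult_1)
    moreover have "Cmon \<le> Cmon\<^sup>2"
      using Cmon_ge_1 by (simp add: self_le_power)
    ultimately show ?thesis
      using mult_mono[of Cmon "Cmon\<^sup>2" 1 "Csum / ?\<rho>"] Cmon_ge_1 by simp
  qed
  show ?thesis
  proof (cases "k = 0")
    case True
    have "Cmon * (tot w (T l))\<^sup>2 \<le> Clin * (tot w (T l))\<^sup>2"
      unfolding Clin_def using C by (intro mult_right_mono) auto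
    with mono[OF \<open>l \<le> m\<close>] show ?thesis
      using True by (simp add: k_def)
  next
    case False
    define b where "b = a + k - 1"
    have b: "b < card (?L \<inter> {..<m})" "a \<le> b" "b - a = k - 1"
      using False ak by (auto simp: b_def)
    have valid: "infinite ?L \<or> b < card ?L"
      using b(1) card_mono[of ?L "?L \<inter> {..<m}"] by (auto intro: less_le_trans)
    have first: "l \<le> enumerate ?L a"
      using enumerate_less_iff[of ?L a l] valid b(2) by (auto simp: a_def not_less)
    have last: "enumerate ?L b \<le> m"
      using enumerate_less_iff[OF valid, of m] b(1) by simp
    have "(tot w (T m))\<^sup>2 \<le> Cmon * (tot w (T (enumerate ?L b)))\<^sup>2"
      using mono[OF last] .
    also have "\<dots> \<le> Cmon * (Csum * ?\<rho> ^ (b - a) * (tot w (T (enumerate ?L a)))\<^sup>2)"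
      using Cmon_ge_1 valid b(2)
      by (intro mult_left_mono linear_decay_of_summable_tails[where m = b
            and e = "\<lambda>j. (tot w (T (enumerate ?L j)))\<^sup>2"] Csum_gt_1 summable_tails_of_steps) auto
    also have "\<dots> \<le> Cmon * (Csum * ?\<rho> ^ (b - a) * (Cmon * (tot w (T l))\<^sup>2))"
      using Cmon_ge_1 Csum_gt_1 mono[OF first] rho_bounds by (intro mult_left_mono) auto
    also have "\<dots> = Clin * ?\<rho> ^ k * (tot w (T l))\<^sup>2"
      using rho_bounds False b(3) power_minus_mult[of k ?\<rho>]
      by (simp add: Clin_def power2_eq_square field_simps)
    finally show ?thesis
      by (simp add: k_def)
  qed
qed

text \<open>
  The exponents for the two problems add up to at least \<open>n\<close> by \<open>step_for_some_problem\<close>.  The decay was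
  proved for squared estimators, hence the square root in \<open>qlin\<close>.
\<close>

lemma linear_convergence: "linear_convergence \<eta> T Clin qlin"
  unfolding linear_convergence_def
proof (intro allI)
  fix l n
  let ?\<rho> = "1 - 1 / Csum"
  let ?k = "\<lambda>w. card (steps w \<inter> {l..<l + n})"
  let ?P = "\<lambda>m. tot Primal (T m) * tot Dual (T m)"
  have P_nonneg: "0 \<le> ?P m" for m
    by (simp add: total_est_nonneg)
  have "{l..<l + n} = (steps Primal \<inter> {l..<l + n}) \<union> (steps Dual \<inter> {l..<l + n})"
    using step_for_some_problem by blast
  then have "n \<le> ?k Primal + ?k Dual"
    using card_Un_le[of "steps Primal \<inter> {l..<l + n}" "steps Dual \<inter> {l..<l + n}"] by simp
  then have k: "?\<rho> ^ (?k Primal + ?k Dual) \<le> ?\<rho> ^ n"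
    using rho_bounds by (intro power_decreasing) auto
  have "(?P (l + n))\<^sup>2 \<le> (Clin * ?\<rho> ^ ?k Primal * (tot Primal (T l))\<^sup>2)
      * (Clin * ?\<rho> ^ ?k Dual * (tot Dual (T l))\<^sup>2)"
    unfolding power_mult_distrib
    using linear_decay_along_steps[of l "l + n" Primal] linear_decay_along_steps[of l "l + n" Dual]
      Clin_pos rho_bounds
    by (intro mult_mono) simp_all
  also have "\<dots> = ?\<rho> ^ (?k Primal + ?k Dual) * (Clin * ?P l)\<^sup>2"
    by (simp only: power_add power_mult_distrib power2_eq_square mult_ac)
  also have "\<dots> \<le> ?\<rho> ^ n * (Clin * ?P l)\<^sup>2"
    using k by (rule mult_right_mono) simp
  also have "?\<rho> ^ n = (qlin ^ n)\<^sup>2"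
    using power_mult[of qlin 2 n] power_mult[of qlin n 2] rho_bounds
    by (simp add: qlin_def mult.commute)
  also have "(qlin ^ n)\<^sup>2 * (Clin * ?P l)\<^sup>2 = (Clin * qlin ^ n * ?P l)\<^sup>2"
    by (simp only: power_mult_distrib mult_ac)
  finally show "?P (l + n) \<le> Clin * qlin ^ n * ?P l"
    using Clin_pos qlin_bounds P_nonneg[of l] by (elim power2_le_imp_le) simp
qed

section \<open>Optimality of Doerfler marking\<close>

text \<open>
  The estimator of \<open>T'\<close> on the common elements exceeds that of \<open>T''\<close>, which is small, at most by a
  multiple of the distance, hence of the estimator on \<open>R\<close>.  The other elements of \<open>T'\<close> lie in \<open>R\<close>.  So
  \<open>R\<close> carries a fixed share of the whole estimator, and for small \<open>\<theta>\<close> that share is at least \<open>\<theta>\<close>.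
\<close>

lemma doerfler_optimal:
  assumes T': "T' \<in> adm" and T'': "T'' \<in> refinements refine T'"
    and decay: "(tot w T'')\<^sup>2 \<le> kappa * (tot w T')\<^sup>2"
  obtains R where "doerfler (\<eta> w) \<theta> T' R" "real (card R) \<le> Crel * real (card (T' - T''))"
proof -
  obtain R where R: "T' - T'' \<subseteq> R" "R \<subseteq> T'" "real (card R) \<le> Crel * real (card (T' - T''))"
    "d w T' T'' \<le> Cdrel * est (\<eta> w) T' R"
    using discrete_reliability[OF T' T''] by metis
  let ?B = "Cstb\<^sup>2 * Cdrel\<^sup>2"
  let ?r = "(est (\<eta> w) T' R)\<^sup>2"
  have adm: "T'' \<in> adm"
    using refinements_trans[OF T'' T'] .
  have fin: "finite R"
    using finite_mesh[OF T'] R(2) by (rule finite_subset[rotated])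
  have "est (\<eta> w) T' (T' \<inter> T'') \<le> est (\<eta> w) T'' (T' \<inter> T'') + Cstb * d w T' T''"
    using A1[of w] T' T'' unfolding axiom_stability_def by (auto simp: abs_le_iff algebra_simps)
  also have "\<dots> \<le> est (\<eta> w) T'' (T' \<inter> T'') + Cstb * (Cdrel * est (\<eta> w) T' R)"
    using R(4) Cstb_pos by simp
  finally have "(est (\<eta> w) T' (T' \<inter> T''))\<^sup>2
      \<le> (Cstb * (Cdrel * est (\<eta> w) T' R) + est (\<eta> w) T'' (T' \<inter> T''))\<^sup>2"
    by (intro power_mono est_nonneg) simp
  also have "\<dots> \<le> (1 + young_weight) * (Cstb * (Cdrel * est (\<eta> w) T' R))\<^sup>2
      + (1 + 1 / young_weight) * (est (\<eta> w) T'' (T' \<inter> T''))\<^sup>2"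
    using young_weight_pos by (rule young_square)
  also have "\<dots> \<le> (1 + young_weight) * (?B * ?r) + (1 + 1 / young_weight) * (kappa * (tot w T')\<^sup>2)"
  proof -
    have "(est (\<eta> w) T'' (T' \<inter> T''))\<^sup>2 \<le> kappa * (tot w T')\<^sup>2"
      using est_power2_mono[OF finite_mesh[OF adm], of "T' \<inter> T''" "\<eta> w" T''] decay
      by (simp add: total_est_def)
    then show ?thesis
      using young_weight_pos by (intro add_mono mult_left_mono) (simp_all add: power_mult_distrib mult.assoc)
  qed
  also have "(1 + 1 / young_weight) * (kappa * (tot w T')\<^sup>2) = slack * (tot w T')\<^sup>2"
  proof -
    have "1 + 1 / young_weight \<noteq> 0"
      using young_weight_pos by (intro less_imp_neq[symmetric] add_pos_pos) auto
    then have "(1 + 1 / young_weight) * kappa = slack"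
      unfolding kappa_def by (metis nonzero_mult_div_cancel_left times_divide_eq_right)
    then show ?thesis
      by (simp only: mult.assoc[symmetric])
  qed
  finally have common: "(est (\<eta> w) T' (T' \<inter> T''))\<^sup>2
      \<le> (1 + young_weight) * (?B * ?r) + slack * (tot w T')\<^sup>2" .
  have "(tot w T')\<^sup>2 = (est (\<eta> w) T' (T' \<inter> T''))\<^sup>2 + (est (\<eta> w) T' (T' - T''))\<^sup>2"
    unfolding total_est_def by (rule est_power2_split[OF finite_mesh[OF T']])
  also have "\<dots> \<le> ((1 + young_weight) * (?B * ?r) + slack * (tot w T')\<^sup>2) + ?r"
    using common est_power2_mono[OF fin R(1)] by (rule add_mono)
  finally have "(1 - slack) * (tot w T')\<^sup>2 \<le> (1 + (1 + young_weight) * ?B) * ?r"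
    by (simp add: algebra_simps)
  from mult_left_mono[OF this less_imp_le[OF theta_pos]]
  have "(1 - slack) * (\<theta> * (tot w T')\<^sup>2) \<le> (\<theta> * (1 + (1 + young_weight) * ?B)) * ?r"
    by (simp only: mult.left_commute mult.assoc)
  also have "\<theta> * (1 + (1 + young_weight) * ?B) = 1 - slack"
  proof -
    have "young_weight * (\<theta> * ?B) = slack"
      unfolding young_weight_def using theta_pos Cstb_pos Cdrel_pos by simp
    then have "\<theta> * (1 + (1 + young_weight) * ?B) = \<theta> * (1 + ?B) + slack"
      by (simp add: algebra_simps)
    also have "\<dots> = 1 - slack"
      by (simp add: slack_def field_simps)
    finally show ?thesis .
  qed
  finally have "(1 - slack) * (\<theta> * (tot w T')\<^sup>2) \<le> (1 - slack) * ?r" .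
  moreover have "0 < 1 - slack"
  proof -
    have "0 < \<theta> * (1 + ?B)"
      using theta_pos by (intro mult_pos_pos add_pos_nonneg) auto
    then show ?thesis
      unfolding slack_def by simp
  qed
  ultimately have "\<theta> * (tot w T')\<^sup>2 \<le> ?r"
    by simp
  with R that show ?thesis
    by (auto simp: doerfler_def)
qed

section \<open>Optimal rates\<close>

abbreviation est_product :: "nat \<Rightarrow> real" where "est_product l \<equiv> tot Primal (T l) * tot Dual (T l)"

text \<open>
  Comparison with near-best meshes that have at most \<open>N\<close> additional elements, where \<open>N\<close> is just
  large enough to make their estimator product at most \<open>kappa / Cmon\<close> times the current one.
\<close>

lemma marking_bound:
  assumes son: "son_estimate refine T0" and overlay: "overlay_estimate refine T0"
    and s: "0 < s" "in_approx_class refine T0 (\<eta> Primal) s"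
    and t: "0 < t" "in_approx_class refine T0 (\<eta> Dual) t"
    and P_pos: "0 < est_product l" and Cmark: "1 \<le> Cmark"
    and A: "A = approx_norm refine T0 (\<eta> Primal) s * approx_norm refine T0 (\<eta> Dual) t"
  shows "real (card (M l)) \<le> Cmark * (2 * Crel) * (A * (Cmon / kappa) / est_product l) powr (1 / (s + t))"
proof -
  define X where "X = (A * (Cmon / kappa) / est_product l) powr (1 / (s + t))"
  \<comment> \<open>\<open>N + 1\<close> reaches \<open>X\<close>, so the meshes are good enough;
    and \<open>N\<close> itself does not exceed \<open>X\<close>, so that no additive constant enters their size\<close>
  define N where "N = nat \<lfloor>X\<rfloor>"
  have A_nonneg: "0 \<le> A"
    unfolding A using approx_norm_nonneg[OF son s(2)] approx_norm_nonneg[OF son t(2)] by simp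
  have X_nonneg: "0 \<le> X"
    by (simp add: X_def)
  then have N: "real N \<le> X" "X \<le> real N + 1"
    by (simp_all add: N_def)
  have N_pow: "A * (Cmon / kappa) / est_product l \<le> (real N + 1) powr (s + t)"
  proof -
    have "A * (Cmon / kappa) / est_product l = X powr (s + t)"
      unfolding X_def powr_powr using A_nonneg Cmon_ge_1 kappa_pos P_pos s(1) t(1) by simp
    also have "\<dots> \<le> (real N + 1) powr (s + t)"
      using N X_nonneg s(1) t(1) by (intro powr_mono2) auto
    finally show ?thesis .
  qed
  obtain Tu where Tu: "Tu \<in> adm" "real (card Tu) \<le> real (card T0) + real N"
    "(real N + 1) powr s * tot Primal Tu \<le> approx_norm refine T0 (\<eta> Primal) s"
    using approx_class_mesh[OF son s(2)] by metis
  obtain Tz where Tz: "Tz \<in> adm" "real (card Tz) \<le> real (card T0) + real N"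
    "(real N + 1) powr t * tot Dual Tz \<le> approx_norm refine T0 (\<eta> Dual) t"
    using approx_class_mesh[OF son t(2)] by metis
  \<comment> \<open>\<open>Ts\<close> refines \<open>Tu\<close>, \<open>Tz\<close> and the current mesh, with at most \<open>2 * N\<close> elements more than the latter\<close>
  obtain To where To: "To \<in> refinements refine Tu" "To \<in> refinements refine Tz"
    "real (card To) \<le> real (card Tu) + real (card Tz) - real (card T0)"
    using overlay Tu(1) Tz(1) unfolding overlay_estimate_def by blast
  have "To \<in> adm"
    using refinements_trans[OF To(1) Tu(1)] .
  then obtain Ts where Ts: "Ts \<in> refinements refine To" "Ts \<in> refinements refine (T l)"
    "real (card Ts) \<le> real (card To) + real (card (T l)) - real (card T0)"
    using overlay run_adm[of l] unfolding overlay_estimate_def by blast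
  have "(real N + 1) powr (s + t) * (tot Primal Tu * tot Dual Tz)
      = ((real N + 1) powr s * tot Primal Tu) * ((real N + 1) powr t * tot Dual Tz)"
    by (simp add: powr_add)
  also have "\<dots> \<le> A"
    unfolding A using Tu(3) Tz(3) approx_norm_nonneg[OF son s(2)]
    by (intro mult_mono) (auto simp: total_est_nonneg)
  finally have coarse: "(real N + 1) powr (s + t) * (tot Primal Tu * tot Dual Tz) \<le> A" .
  have approx: "Cmon * (tot Primal Tu * tot Dual Tz) \<le> kappa * est_product l"
  proof (cases "A = 0")
    case True
    with coarse have "(real N + 1) powr (s + t) * (tot Primal Tu * tot Dual Tz)
        \<le> (real N + 1) powr (s + t) * 0"
      by simp
    then have "tot Primal Tu * tot Dual Tz \<le> 0"
      by (rule mult_left_le_imp_le) simp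
    then have "Cmon * (tot Primal Tu * tot Dual Tz) \<le> 0"
      by (rule mult_nonneg_nonpos[rotated]) (use Cmon_ge_1 in simp)
    also have "0 \<le> kappa * est_product l"
      using kappa_pos by (intro mult_nonneg_nonneg total_est_nonneg) simp
    finally show ?thesis .
  next
    case False
    have "A * (Cmon / kappa / est_product l * (tot Primal Tu * tot Dual Tz))
        \<le> (real N + 1) powr (s + t) * (tot Primal Tu * tot Dual Tz)"
      using mult_right_mono[OF N_pow, of "tot Primal Tu * tot Dual Tz"]
      by (simp add: total_est_nonneg)
    also have "\<dots> \<le> A * 1"
      using coarse by simp
    finally have "Cmon / kappa / est_product l * (tot Primal Tu * tot Dual Tz) \<le> 1"
      by (rule mult_left_le_imp_le) (use False A_nonneg in simp)
    then have "Cmon * (tot Primal Tu * tot Dual Tz) / (kappa * est_product l) \<le> 1"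
      by simp
    then show ?thesis
      by (rule iffD1[OF divide_le_eq_1_pos, rotated]) (use kappa_pos P_pos in \<open>rule mult_pos_pos\<close>)
  qed
  have "(tot Primal Ts)\<^sup>2 * (tot Dual Ts)\<^sup>2
      \<le> (Cmon * (tot Primal Tu)\<^sup>2) * (Cmon * (tot Dual Tz)\<^sup>2)"
    using quasi_monotone[OF Tu(1) refinements_trans[OF Ts(1) To(1)], of Primal]
      quasi_monotone[OF Tz(1) refinements_trans[OF Ts(1) To(2)], of Dual] Cmon_ge_1
    by (intro mult_mono) auto
  also have "\<dots> = (Cmon * (tot Primal Tu * tot Dual Tz))\<^sup>2"
    by (simp only: power_mult_distrib power2_eq_square mult_ac)
  also have "\<dots> \<le> (kappa * est_product l)\<^sup>2"
    using approx Cmon_ge_1 by (intro power_mono) (auto simp: total_est_nonneg)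
  also have "\<dots> = (kappa * (tot Primal (T l))\<^sup>2) * (kappa * (tot Dual (T l))\<^sup>2)"
    by (simp only: power_mult_distrib power2_eq_square mult_ac)
  finally have prod: "(tot Primal Ts)\<^sup>2 * (tot Dual Ts)\<^sup>2
      \<le> (kappa * (tot Primal (T l))\<^sup>2) * (kappa * (tot Dual (T l))\<^sup>2)" .
  \<comment> \<open>a product of two nonnegative factors can be small only if one of them is\<close>
  obtain w where w: "(tot w Ts)\<^sup>2 \<le> kappa * (tot w (T l))\<^sup>2"
  proof (rule ccontr)
    assume "\<not> thesis"
    then have "kappa * (tot w (T l))\<^sup>2 < (tot w Ts)\<^sup>2" for w
      using that not_le by blast
    then have "(kappa * (tot Primal (T l))\<^sup>2) * (kappa * (tot Dual (T l))\<^sup>2)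
        < (tot Primal Ts)\<^sup>2 * (tot Dual Ts)\<^sup>2"
      using kappa_pos by (intro mult_strict_mono') auto
    with prod show False
      by simp
  qed
  obtain R where R: "doerfler (\<eta> w) \<theta> (T l) R" "real (card R) \<le> Crel * real (card (T l - Ts))"
    using doerfler_optimal[OF run_adm Ts(2) w] by metis
  have "real (card (T l - Ts)) + real (card (T l)) \<le> real (card Ts)"
    using card_refinement_le[OF son run_adm Ts(2)] by linarith
  then have "real (card (T l - Ts)) \<le> 2 * X"
    using Ts(3) To(3) Tu(2) Tz(2) N(1) by linarith
  then have card_R: "real (card R) \<le> Crel * (2 * X)"
    using R(2) Crel_pos by (smt (verit) mult_left_mono)
  have "real (card (M l)) \<le> Cmark * real (card R)"
  proof (rule run_step[of l])
    fix Mw :: "problem \<Rightarrow> 'e set"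
    assume "\<And>w U. doerfler (\<eta> w) \<theta> (T l) U \<Longrightarrow> real (card (Mw w)) \<le> Cmark * real (card U)"
      and "card (M l) = min (card (Mw Primal)) (card (Mw Dual))"
    moreover from this(2) have "card (M l) \<le> card (Mw w)"
      by (cases w) auto
    ultimately show ?thesis
      using R(1) by (meson of_nat_mono order_trans)
  qed
  also have "\<dots> \<le> Cmark * (Crel * (2 * X))"
    using card_R Cmark by (intro mult_left_mono) auto
  finally show ?thesis
    by (simp add: X_def mult_ac)
qed

text \<open>
  Linear convergence bounds \<open>est_product j\<close> for \<open>j < l\<close> from below by a geometrically growing multiple of
  \<open>est_product l\<close>, so the marking bounds form a geometric series with ratio \<open>q powr (1 / (s + t))\<close>.
\<close>

lemma cardinality_bound:
  assumes lin: "linear_convergence \<eta> T C q" and C: "0 < C" and q: "0 < q" "q < 1"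
    and son: "son_estimate refine T0" and overlay: "overlay_estimate refine T0"
    and closure: "closure_estimate T0 Cmesh T M" and Cmesh: "0 < Cmesh" and Cmark: "1 \<le> Cmark"
    and s: "0 < s" "in_approx_class refine T0 (\<eta> Primal) s"
    and t: "0 < t" "in_approx_class refine T0 (\<eta> Dual) t"
    and P_pos: "0 < est_product l"
    and A: "A = approx_norm refine T0 (\<eta> Primal) s * approx_norm refine T0 (\<eta> Dual) t"
  shows "real (card (T l)) - real (card T0)
    \<le> Cmesh * (Cmark * (2 * Crel)) * (A * (Cmon / kappa * C) / est_product l) powr (1 / (s + t))
      / (1 - q powr (1 / (s + t)))"
proof -
  define r where "r = 1 / (s + t)"
  define Y where "Y = (A * (Cmon / kappa * C) / est_product l) powr r"
  define D where "D = Cmark * (2 * Crel)"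
  have r: "0 < r"
    using s(1) t(1) by (simp add: r_def)
  have A_nonneg: "0 \<le> A"
    unfolding A using approx_norm_nonneg[OF son s(2)] approx_norm_nonneg[OF son t(2)] by simp
  have D: "0 \<le> D"
    using Cmark Crel_pos by (simp add: D_def)
  have qr: "0 \<le> q powr r" "q powr r < 1"
    using q r powr_less_mono2[of r q 1] by auto
  have marked: "real (card (M j)) \<le> D * (Y * (q powr r) ^ (l - j))" if "j < l" for j
  proof -
    have decay: "est_product l \<le> C * q ^ (l - j) * est_product j"
      using lin[unfolded linear_convergence_def, rule_format, of j "l - j"] that by simp
    have Pj: "0 < est_product j"
    proof (rule ccontr)
      assume "\<not> 0 < est_product j"
      then have "est_product j = 0"
        using mult_nonneg_nonneg[OF total_est_nonneg total_est_nonneg, of "\<eta> Primal" "T j" "\<eta> Dual" "T j"]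
        by linarith
      with decay P_pos show False
        by simp
    qed
    have "1 / est_product j \<le> C * q ^ (l - j) / est_product l"
      using decay Pj P_pos by (simp add: field_simps)
    then have "A * (Cmon / kappa) * (1 / est_product j) \<le> A * (Cmon / kappa) * (C * q ^ (l - j) / est_product l)"
      using A_nonneg Cmon_ge_1 kappa_pos by (intro mult_left_mono) auto
    then have "A * (Cmon / kappa) / est_product j \<le> A * (Cmon / kappa * C) / est_product l * q ^ (l - j)"
      by (simp add: mult_ac)
    moreover have "0 \<le> A * (Cmon / kappa) / est_product j"
      using A_nonneg Cmon_ge_1 kappa_pos
      by (intro divide_nonneg_nonneg mult_nonneg_nonneg total_est_nonneg) auto
    ultimately have "(A * (Cmon / kappa) / est_product j) powr r
        \<le> (A * (Cmon / kappa * C) / est_product l * q ^ (l - j)) powr r"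
      using r by (intro powr_mono2) auto
    also have "\<dots> = Y * (q powr r) ^ (l - j)"
    proof -
      have "(q ^ k) powr r = (q powr r) ^ k" for k
        using powr_realpow[OF q(1), of k] powr_powr[of q "real k" r] q by (simp add: powr_power)
      then show ?thesis
        unfolding Y_def powr_mult by simp
    qed
    finally have "D * (A * (Cmon / kappa) / est_product j) powr r \<le> D * (Y * (q powr r) ^ (l - j))"
      using D by (rule mult_left_mono)
    with marking_bound[OF son overlay s t Pj Cmark A] show ?thesis
      by (simp add: D_def r_def)
  qed
  have "real (card (T l)) - real (card T0) \<le> Cmesh * (\<Sum>j<l. real (card (M j)))"
    using closure by (simp add: closure_estimate_def)
  also have "\<dots> \<le> Cmesh * (\<Sum>j<l. D * (Y * (q powr r) ^ (l - j)))"
    using Cmesh by (intro mult_left_mono sum_mono marked) auto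
  also have "\<dots> = Cmesh * D * Y * (\<Sum>j<l. (q powr r) ^ (l - j))"
    by (simp add: sum_distrib_left mult.assoc)
  also have "\<dots> \<le> Cmesh * D * Y * (1 / (1 - q powr r))"
    using Cmesh D qr by (intro mult_left_mono geometric_sum_le) (auto simp: Y_def)
  finally show ?thesis
    by (simp add: D_def Y_def r_def)
qed

lemma optimal_rate:
  assumes lin: "linear_convergence \<eta> T C q" and C: "0 < C" and q: "0 < q" "q < 1"
    and son: "son_estimate refine T0" and overlay: "overlay_estimate refine T0"
    and closure: "closure_estimate T0 Cmesh T M" and Cmesh: "0 < Cmesh" and Cmark: "1 \<le> Cmark"
    and s: "0 < s" "in_approx_class refine T0 (\<eta> Primal) s"
    and t: "0 < t" "in_approx_class refine T0 (\<eta> Dual) t"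
    and refined: "card (T l) \<noteq> card T0"
    and Copt: "Cmesh * (Cmark * (2 * Crel)) \<le> Copt" "Cmon / kappa * C \<le> Copt"
  shows "est_product l \<le> Copt powr (1 + s + t) / (1 - q powr (1 / (s + t))) powr (s + t)
    * (approx_norm refine T0 (\<eta> Primal) s * approx_norm refine T0 (\<eta> Dual) t)
    * (real (card (T l)) - real (card T0)) powr (- (s + t))"
proof -
  define A where "A = approx_norm refine T0 (\<eta> Primal) s * approx_norm refine T0 (\<eta> Dual) t"
  define n where "n = real (card (T l)) - real (card T0)"
  define r where "r = s + t"
  define D where "D = Cmesh * (Cmark * (2 * Crel))"
  define gp where "gp = 1 - q powr (1 / r)"
  have r: "0 < r"
    using s(1) t(1) by (simp add: r_def)
  have A_nonneg: "0 \<le> A"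
    unfolding A_def using approx_norm_nonneg[OF son s(2)] approx_norm_nonneg[OF son t(2)] by simp
  have D: "0 < D"
    using Cmesh Cmark Crel_pos by (simp add: D_def)
  have gp: "0 < gp"
    using q r powr_less_mono2[of "1 / r" q 1] by (simp add: gp_def)
  have "card T0 \<le> card (T l)"
    using card_refinement_le[OF son refinements.base run_adm, of l] by linarith
  with refined have n: "0 < n"
    by (simp add: n_def)
  have Copt_pos: "0 < Copt"
    using D Copt(1) unfolding D_def by (rule less_le_trans)
  have "est_product l \<le> Copt powr (1 + r) / gp powr r * A * n powr (- r)"
  proof (cases "0 < est_product l")
    case False
    then have "est_product l \<le> 0"
      by simp
    also have "0 \<le> Copt powr (1 + r) / gp powr r * A * n powr (- r)"
      using A_nonneg by simp
    finally show ?thesis .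
  next
    case True
    let ?Y = "A * (Cmon / kappa * C) / est_product l"
    have Y: "0 \<le> ?Y"
      using A_nonneg Cmon_ge_1 kappa_pos C True by simp
    have "n \<le> D * ?Y powr (1 / r) / gp"
      using cardinality_bound[OF lin C q son overlay closure Cmesh Cmark s t True A_def]
      by (simp add: n_def D_def r_def gp_def)
    then have "n powr r \<le> (D * ?Y powr (1 / r) / gp) powr r"
      using n r by (intro powr_mono2) auto
    also have "\<dots> = D powr r * ?Y / gp powr r"
    proof -
      have "(D * y powr (1 / r) / gp) powr r = D powr r * y / gp powr r" if "0 \<le> y" for y
        using D that gp r by (simp add: powr_divide powr_mult powr_powr)
      then show ?thesis
        using Y .
    qed
    also have "\<dots> = D powr r * (Cmon / kappa * C) * A / (est_product l * gp powr r)"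
      by (simp add: mult_ac)
    finally have "n powr r * (est_product l * gp powr r) \<le> D powr r * (Cmon / kappa * C) * A"
      by (rule iffD1[OF pos_le_divide_eq, rotated]) (rule mult_pos_pos[OF True], use gp in simp)
    also have "\<dots> \<le> Copt powr r * Copt * A"
      using Copt D A_nonneg Cmon_ge_1 kappa_pos C r Copt_pos
      by (intro mult_right_mono mult_mono powr_mono2) (auto simp: D_def)
    also have "\<dots> = Copt powr (1 + r) * A"
      using Copt_pos by (simp add: powr_add)
    finally have bound: "est_product l * (n powr r * gp powr r) \<le> Copt powr (1 + r) * A"
      by (simp only: mult_ac)
    have "0 < n powr r * gp powr r"
      using n gp by (intro mult_pos_pos) auto
    from iffD2[OF pos_le_divide_eq[OF this] bound]
    show ?thesis
      by (simp only: powr_minus divide_inverse inverse_mult_distrib mult_ac)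
  qed
  then show ?thesis
    by (simp only: A_def n_def r_def gp_def add.assoc)
qed

end

theorem theorem17:
  fixes Cdist Cstb qred Cred Crel :: real and Corth :: "real \<Rightarrow> real"
  assumes "0 < Cdist" and "0 < Cstb" and "0 < qred" and "qred < 1" and "0 < Cred"
    and "\<And>\<epsilon>. 0 < \<epsilon> \<Longrightarrow> 0 < Corth \<epsilon>" and "0 < Crel"
  shows "\<exists>\<theta>0. 0 < \<theta>0 \<and> \<theta>0 \<le> inverse (1 + Cstb\<^sup>2 * Crel\<^sup>2) \<and>
    (Cdist \<le> 1 \<longrightarrow> \<theta>0 = inverse (1 + Cstb\<^sup>2 * Crel\<^sup>2)) \<and>
    (\<forall>\<theta>. 0 < \<theta> \<and> \<theta> < \<theta>0 \<longrightarrow>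
      (\<exists>Clin qlin. 0 < Clin \<and> 0 < qlin \<and> qlin < 1 \<and>
        (\<forall>(refine :: 'e set \<Rightarrow> 'e set \<Rightarrow> 'e set) T0 \<eta> d Cmark T M.
          1 \<le> Cmark \<and>
          adaptive_setting refine T0 \<eta> d Cdist Cstb qred Cred Corth Crel \<theta> Cmark T M \<longrightarrow>
          linear_convergence \<eta> T Clin qlin)) \<and>
      (\<forall>Clin qlin Cmesh Cmark.
        0 < Clin \<and> 0 < qlin \<and> qlin < 1 \<and> 0 < Cmesh \<and> 1 \<le> Cmark \<longrightarrow>
        (\<exists>Copt>0. \<forall>(refine :: 'e set \<Rightarrow> 'e set \<Rightarrow> 'e set) T0 \<eta> d T M g gl Cgoal.
          adaptive_setting refine T0 \<eta> d Cdist Cstb qred Cred Corth Crel \<theta> Cmark T M \<and>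
          linear_convergence \<eta> T Clin qlin \<and>
          son_estimate refine T0 \<and> closure_estimate T0 Cmesh T M \<and> overlay_estimate refine T0 \<and>
          0 < Cgoal \<and>
          (\<forall>l. \<bar>g - gl l\<bar>
            \<le> Cgoal * (total_est (\<eta> Primal) (T l) * total_est (\<eta> Dual) (T l))) \<longrightarrow>
          (\<forall>s t. 0 < s \<and> 0 < t \<and>
            in_approx_class refine T0 (\<eta> Primal) s \<and> in_approx_class refine T0 (\<eta> Dual) t \<longrightarrow>
            (\<forall>l. inverse Cgoal * \<bar>g - gl l\<bar>
                \<le> total_est (\<eta> Primal) (T l) * total_est (\<eta> Dual) (T l) \<and>
              (card (T l) \<noteq> card T0 \<longrightarrow>
                total_est (\<eta> Primal) (T l) * total_est (\<eta> Dual) (T l)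
                  \<le> Copt powr (1 + s + t) / (1 - qlin powr (1 / (s + t))) powr (s + t)
                    * (approx_norm refine T0 (\<eta> Primal) s * approx_norm refine T0 (\<eta> Dual) t)
                    * (real (card (T l)) - real (card T0)) powr (- (s + t))))))))"
proof -
  define \<theta>0 where "\<theta>0 = inverse (1 + Cstb\<^sup>2 * (max 1 Cdist * Crel)\<^sup>2)"
  have "Cstb\<^sup>2 * Crel\<^sup>2 \<le> Cstb\<^sup>2 * (max 1 Cdist * Crel)\<^sup>2"
    using mult_right_mono[of 1 "max 1 Cdist" Crel] \<open>0 < Crel\<close>
    by (intro mult_left_mono power_mono) auto
  moreover have denominator_pos: "0 < 1 + Cstb\<^sup>2 * (c * Crel)\<^sup>2" for c
    by (intro add_pos_nonneg) auto
  ultimately have \<theta>0: "0 < \<theta>0" "\<theta>0 \<le> inverse (1 + Cstb\<^sup>2 * Crel\<^sup>2)"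
    unfolding \<theta>0_def using denominator_pos[of 1] by (auto intro: le_imp_inverse_le)
  have \<theta>0_eq: "Cdist \<le> 1 \<longrightarrow> \<theta>0 = inverse (1 + Cstb\<^sup>2 * Crel\<^sup>2)"
    by (simp add: \<theta>0_def)
  have constants: "adaptivity_constants Cdist Cstb qred Cred Corth Crel \<theta>"
    if "0 < \<theta>" "\<theta> < \<theta>0" for \<theta>
  proof
    show "\<theta> * (1 + Cstb\<^sup>2 * (max 1 Cdist * Crel)\<^sup>2) < 1"
      using that(2) denominator_pos[of "max 1 Cdist"] by (simp add: \<theta>0_def field_simps)
  qed (use assms that in auto)
  show ?thesis
  proof (rule exI[of _ \<theta>0], intro conjI allI impI; (elim conjE)?)
    show "0 < \<theta>0" "\<theta>0 \<le> inverse (1 + Cstb\<^sup>2 * Crel\<^sup>2)"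
      using \<theta>0 by simp_all
    show "\<theta>0 = inverse (1 + Cstb\<^sup>2 * Crel\<^sup>2)" if "Cdist \<le> 1"
      using \<theta>0_eq that by simp
  next
    fix \<theta>
    assume "0 < \<theta>" "\<theta> < \<theta>0"
    then interpret adaptivity_constants Cdist Cstb qred Cred Corth Crel \<theta>
      by (rule constants)
    show "\<exists>Clin qlin. 0 < Clin \<and> 0 < qlin \<and> qlin < 1 \<and>
        (\<forall>(refine :: 'e set \<Rightarrow> 'e set \<Rightarrow> 'e set) T0 \<eta> d Cmark T M.
          1 \<le> Cmark \<and>
          adaptive_setting refine T0 \<eta> d Cdist Cstb qred Cred Corth Crel \<theta> Cmark T M \<longrightarrow>
          linear_convergence \<eta> T Clin qlin)"
    proof (rule exI[of _ Clin], rule exI[of _ qlin], intro conjI allI impI; (elim conjE)?)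
      fix refine :: "'e set \<Rightarrow> 'e set \<Rightarrow> 'e set" and T0 \<eta> d Cmark T M
      assume "adaptive_setting refine T0 \<eta> d Cdist Cstb qred Cred Corth Crel \<theta> Cmark T M"
      then interpret adaptive_run refine T0 \<eta> d Cdist Cstb qred Cred Corth Crel \<theta> Cmark T M
        by (simp add: adaptive_run_def adaptivity_constants_axioms)
      show "linear_convergence \<eta> T Clin qlin"
        by (rule linear_convergence)
    qed (use Clin_pos qlin_bounds in auto)
  next
    fix \<theta> C q Cmesh Cmark :: real
    assume "0 < \<theta>" "\<theta> < \<theta>0"
    then interpret adaptivity_constants Cdist Cstb qred Cred Corth Crel \<theta>
      by (rule constants)
    assume pos: "0 < C" "0 < q" "q < 1" "0 < Cmesh" "1 \<le> Cmark"
    \<comment> \<open>the first constant enters the rate with the power \<open>s + t\<close>, the second with the power 1\<close>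
    define Copt where "Copt = max (Cmesh * (Cmark * (2 * Crel))) (Cmon / kappa * C)"
    have Copt: "0 < Copt" "Cmesh * (Cmark * (2 * Crel)) \<le> Copt" "Cmon / kappa * C \<le> Copt"
      using pos \<open>0 < Crel\<close> by (auto simp: Copt_def less_max_iff_disj)
    show "\<exists>Copt>0. \<forall>(refine :: 'e set \<Rightarrow> 'e set \<Rightarrow> 'e set) T0 \<eta> d T M g gl Cgoal.
          adaptive_setting refine T0 \<eta> d Cdist Cstb qred Cred Corth Crel \<theta> Cmark T M \<and>
          linear_convergence \<eta> T C q \<and>
          son_estimate refine T0 \<and> closure_estimate T0 Cmesh T M \<and> overlay_estimate refine T0 \<and>
          0 < Cgoal \<and>
          (\<forall>l. \<bar>g - gl l\<bar>
            \<le> Cgoal * (total_est (\<eta> Primal) (T l) * total_est (\<eta> Dual) (T l))) \<longrightarrow>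
          (\<forall>s t. 0 < s \<and> 0 < t \<and>
            in_approx_class refine T0 (\<eta> Primal) s \<and> in_approx_class refine T0 (\<eta> Dual) t \<longrightarrow>
            (\<forall>l. inverse Cgoal * \<bar>g - gl l\<bar>
                \<le> total_est (\<eta> Primal) (T l) * total_est (\<eta> Dual) (T l) \<and>
              (card (T l) \<noteq> card T0 \<longrightarrow>
                total_est (\<eta> Primal) (T l) * total_est (\<eta> Dual) (T l)
                  \<le> Copt powr (1 + s + t) / (1 - q powr (1 / (s + t))) powr (s + t)
                    * (approx_norm refine T0 (\<eta> Primal) s * approx_norm refine T0 (\<eta> Dual) t)
                    * (real (card (T l)) - real (card T0)) powr (- (s + t)))))"
    proof (rule exI[of _ Copt], intro conjI allI impI; (elim conjE)?)
      show "0 < Copt"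
        by (rule Copt(1))
    next
      fix T :: "nat \<Rightarrow> 'e set" and \<eta> :: "problem \<Rightarrow> 'e set \<Rightarrow> 'e \<Rightarrow> real"
        and g Cgoal :: real and gl :: "nat \<Rightarrow> real" and l
      assume "0 < Cgoal" and "\<forall>l. \<bar>g - gl l\<bar>
        \<le> Cgoal * (total_est (\<eta> Primal) (T l) * total_est (\<eta> Dual) (T l))"
      then show "inverse Cgoal * \<bar>g - gl l\<bar>
          \<le> total_est (\<eta> Primal) (T l) * total_est (\<eta> Dual) (T l)"
        by (simp add: field_simps)
    next
      fix refine :: "'e set \<Rightarrow> 'e set \<Rightarrow> 'e set" and T0 \<eta> d T M and s t :: real and l
      assume "adaptive_setting refine T0 \<eta> d Cdist Cstb qred Cred Corth Crel \<theta> Cmark T M"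
      then interpret adaptive_run refine T0 \<eta> d Cdist Cstb qred Cred Corth Crel \<theta> Cmark T M
        by (simp add: adaptive_run_def adaptivity_constants_axioms)
      assume "linear_convergence \<eta> T C q" "son_estimate refine T0"
        "closure_estimate T0 Cmesh T M" "overlay_estimate refine T0" "0 < s" "0 < t"
        "in_approx_class refine T0 (\<eta> Primal) s" "in_approx_class refine T0 (\<eta> Dual) t"
        "card (T l) \<noteq> card T0"
      then show "total_est (\<eta> Primal) (T l) * total_est (\<eta> Dual) (T l)
          \<le> Copt powr (1 + s + t) / (1 - q powr (1 / (s + t))) powr (s + t)
            * (approx_norm refine T0 (\<eta> Primal) s * approx_norm refine T0 (\<eta> Dual) t)
            * (real (card (T l)) - real (card T0)) powr (- (s + t))"
        using pos Copt(2,3) by (intro optimal_rate)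
    qed
  qed
qed

end
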